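(* The group $\mathrm{PSL}_2(\mathbf{Z})\simeq(\mathbf{Z}/2\mathbf{Z})*(\mathbf{Z}/3\mathbf{Z})$ admits a faithful and highly transitive action on a countably infinite set. The group $\mathrm{SL}_2(\mathbf{Z})$ admits a highly transitive action on a countably infinite set, but it does not admit any faithful and highly transitive action.
   Context: An action of a group $\Gamma$ on a set $X$ is faithful if the corresponding homomorphism $\Gamma\to\mathrm{Sym}(X)$ is injective. For a countably infinite group $\Gamma$ and a countably infinite set $X$, an action $\Gamma\curvearrowright X$ is called highly transitive if for every integer $k\ge 1$ the diagonal action of $\Gamma$ on $X^{(k)}=\{(x_1,\dots,x_k)\in X^k : x_i\neq x_j \text{ for all } i\neq j\}$ is transitive. Highly transitive actions are only considered on countably infinite sets. *)

theory Defs
  imports "HOL-Analysis.Determinants" "HOL-Library.Countable_Set" "HOL-Algebra.Group_Action" "HOL-Algebra.Elementary_Groups"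
begin

section \<open>The modular group\<close>

definition SL2Z :: "(int^2^2) monoid" where
  "SL2Z = \<lparr>carrier = {A. det A = 1}, mult = (**), one = mat 1\<rparr>"

definition PSL2Z :: "(int^2^2) set monoid" where
  "PSL2Z = SL2Z Mod {mat 1, - mat 1}"

lemma group_SL2Z: "group SL2Z"
proof (rule groupI)
  fix A assume "A \<in> carrier SL2Z"
  then have d: "A$1$1 * A$2$2 - A$1$2 * A$2$1 = 1" by (simp add: SL2Z_def det_2)
  define B :: "int^2^2" where
    "B = (\<chi> i j. if i = j then A$(if i = 1 then 2 else 1)$(if i = 1 then 2 else 1) else - A$i$j)"
  have [simp]: "B$1$1 = A$2$2" "B$2$2 = A$1$1" "B$1$2 = - A$1$2" "B$2$1 = - A$2$1"
    by (simp_all add: B_def)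
  have "det B = 1" using d by (simp add: det_2 algebra_simps)
  moreover have "B ** A = mat 1"
    using d by (simp add: vec_eq_iff matrix_matrix_mult_def mat_def forall_2 sum_2 algebra_simps)
  ultimately show "\<exists>B\<in>carrier SL2Z. B \<otimes>\<^bsub>SL2Z\<^esub> A = \<one>\<^bsub>SL2Z\<^esub>"
    by (auto simp: SL2Z_def)
qed (simp_all add: SL2Z_def det_mul matrix_mul_assoc)

lemma normal_pm_one: "{mat 1, - mat 1} \<lhd> SL2Z"
proof -
  interpret group SL2Z by (rule group_SL2Z)
  have c: "- mat 1 ** A = - A" "A ** - mat 1 = - A" for A :: "int^2^2"
    by (simp_all add: vec_eq_iff matrix_matrix_mult_def mat_def forall_2 sum_2)
  have d: "det (- mat 1 :: int^2^2) = 1" by (simp add: det_2 mat_def)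
  have s: "subgroup {mat 1, - mat 1} SL2Z"
  proof (rule subgroupI)
    fix a assume "a \<in> {mat 1, - mat 1 :: int^2^2}"
    then have "inv\<^bsub>SL2Z\<^esub> a = a"
      by (intro inv_equality) (auto simp: SL2Z_def c d)
    with \<open>a \<in> _\<close> show "inv\<^bsub>SL2Z\<^esub> a \<in> {mat 1, - mat 1}" by simp
  qed (auto simp: SL2Z_def c d)
  show ?thesis
    by (rule normalI[OF s]) (auto simp: r_coset_def l_coset_def SL2Z_def c)
qed

lemma group_PSL2Z: "group PSL2Z"
  unfolding PSL2Z_def by (rule normal.factorgroup_is_group[OF normal_pm_one])


section \<open>Free products\<close>

text \<open>The free product is the monoid of words over the disjoint union of the two carriers, modulo
  the congruence generated by deleting neutral letters and multiplying adjacent letters that come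
  from the same factor.\<close>

inductive free_product_eq ::
    "('a, 'c) monoid_scheme \<Rightarrow> ('b, 'd) monoid_scheme \<Rightarrow> ('a + 'b) list \<Rightarrow> ('a + 'b) list \<Rightarrow> bool"
  for G H where
  refl: "u \<in> lists (carrier G <+> carrier H) \<Longrightarrow> free_product_eq G H u u"
| sym: "free_product_eq G H u v \<Longrightarrow> free_product_eq G H v u"
| trans: "\<lbrakk>free_product_eq G H u v; free_product_eq G H v w\<rbrakk> \<Longrightarrow> free_product_eq G H u w"
| append: "\<lbrakk>free_product_eq G H u u'; free_product_eq G H v v'\<rbrakk>
    \<Longrightarrow> free_product_eq G H (u @ v) (u' @ v')"
| one_left: "free_product_eq G H [Inl \<one>\<^bsub>G\<^esub>] []"
| one_right: "free_product_eq G H [Inr \<one>\<^bsub>H\<^esub>] []"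
| mult_left: "\<lbrakk>x \<in> carrier G; y \<in> carrier G\<rbrakk>
    \<Longrightarrow> free_product_eq G H [Inl x, Inl y] [Inl (x \<otimes>\<^bsub>G\<^esub> y)]"
| mult_right: "\<lbrakk>s \<in> carrier H; t \<in> carrier H\<rbrakk>
    \<Longrightarrow> free_product_eq G H [Inr s, Inr t] [Inr (s \<otimes>\<^bsub>H\<^esub> t)]"

definition free_product ::
    "('a, 'c) monoid_scheme \<Rightarrow> ('b, 'd) monoid_scheme \<Rightarrow> ('a + 'b) list set monoid" where
  "free_product G H =
    (let R = {(u, v). free_product_eq G H u v} in
      \<lparr>carrier = lists (carrier G <+> carrier H) // R,
       mult = (\<lambda>A B. \<Union>u\<in>A. \<Union>v\<in>B. R `` {u @ v}),
       one = R `` {[]}\<rparr>)"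

lemma free_product_eq_in_words:
  assumes "group G" "group H" "free_product_eq G H u v"
  shows "u \<in> lists (carrier G <+> carrier H) \<and> v \<in> lists (carrier G <+> carrier H)"
proof -
  interpret G: group G by fact
  interpret H: group H by fact
  show ?thesis using assms(3) by induction auto
qed

lemma equiv_free_product_eq:
  assumes "group G" "group H"
  shows "equiv (lists (carrier G <+> carrier H)) {(u, v). free_product_eq G H u v}"
proof (rule equivI)
  show "{(u, v). free_product_eq G H u v} \<subseteq>
      lists (carrier G <+> carrier H) \<times> lists (carrier G <+> carrier H)"
    using free_product_eq_in_words[OF assms] by blast
  show "refl_on (lists (carrier G <+> carrier H)) {(u, v). free_product_eq G H u v}"
    by (rule refl_onI) (simp add: free_product_eq.refl)
  show "sym {(u, v). free_product_eq G H u v}"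
    by (rule symI) (simp add: free_product_eq.sym)
  show "trans {(u, v). free_product_eq G H u v}"
    by (rule transI) (simp, erule (1) free_product_eq.trans)
qed

lemma mult_free_product:
  assumes "group G" "group H"
    and "u \<in> lists (carrier G <+> carrier H)" "v \<in> lists (carrier G <+> carrier H)"
  shows "{(u, v). free_product_eq G H u v} `` {u} \<otimes>\<^bsub>free_product G H\<^esub>
      {(u, v). free_product_eq G H u v} `` {v} = {(u, v). free_product_eq G H u v} `` {u @ v}"
proof -
  let ?R = "{(u, v). free_product_eq G H u v}"
  have eq: "?R `` {u' @ v'} = ?R `` {u @ v}" if "u' \<in> ?R `` {u}" "v' \<in> ?R `` {v}" for u' v'
  proof -
    have "free_product_eq G H (u @ v) (u' @ v')"
      using that by (simp add: free_product_eq.append)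
    then have "(u @ v, u' @ v') \<in> ?R" by simp
    then show ?thesis
      using equiv_class_eq[OF equiv_free_product_eq[OF assms(1,2)]] by metis
  qed
  have ne: "u \<in> ?R `` {u}" "v \<in> ?R `` {v}"
    using assms by (simp_all add: free_product_eq.refl)
  have "?R `` {u} \<otimes>\<^bsub>free_product G H\<^esub> ?R `` {v}
      = (\<Union>u'\<in>?R `` {u}. \<Union>v'\<in>?R `` {v}. ?R `` {u' @ v'})"
    by (simp add: free_product_def Let_def)
  also have "\<dots> = (\<Union>u'\<in>?R `` {u}. \<Union>v'\<in>?R `` {v}. ?R `` {u @ v})"
    by (intro SUP_cong HOL.refl eq)
  also have "\<dots> = ?R `` {u @ v}"
    using ne by blast
  finally show ?thesis .
qed

lemma group_free_product:
  assumes "group G" "group H"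
  shows "group (free_product G H)"
proof -
  interpret G: group G by fact
  interpret H: group H by fact
  let ?W = "lists (carrier G <+> carrier H)"
  let ?R = "{(u, v). free_product_eq G H u v}"
  let ?P = "free_product G H"
  note mult = mult_free_product[OF assms]
  have carr: "carrier ?P = ?W // ?R" and one: "\<one>\<^bsub>?P\<^esub> = ?R `` {[]}"
    by (simp_all add: free_product_def Let_def)
  have cls: "?R `` {u} = ?R `` {v}" if "free_product_eq G H u v" for u v
    using equiv_class_eq[OF equiv_free_product_eq[OF assms]] that by blast
  have repr: "\<exists>u. u \<in> ?W \<and> A = ?R `` {u}" if "A \<in> carrier ?P" for A
    using that unfolding carr quotient_def by blast
  have inv: "\<exists>v\<in>?W. free_product_eq G H (v @ u) []" if "u \<in> ?W" for u
    using that
  proof (induction u)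
    case Nil
    then show ?case by (auto intro: free_product_eq.refl)
  next
    case (Cons x u)
    then obtain v where v: "v \<in> ?W" "free_product_eq G H (v @ u) []" by auto
    have "\<exists>y\<in>carrier G <+> carrier H. free_product_eq G H [y, x] []"
    proof (cases x)
      case (Inl a)
      with Cons have "a \<in> carrier G" by auto
      then have "free_product_eq G H [Inl (inv\<^bsub>G\<^esub> a), Inl a] []"
        by (metis G.inv_closed G.l_inv free_product_eq.mult_left free_product_eq.one_left
            free_product_eq.trans)
      with Inl \<open>a \<in> _\<close> show ?thesis by blast
    next
      case (Inr a)
      with Cons have "a \<in> carrier H" by auto
      then have "free_product_eq G H [Inr (inv\<^bsub>H\<^esub> a), Inr a] []"
        by (metis H.inv_closed H.l_inv free_product_eq.mult_right free_product_eq.one_right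
            free_product_eq.trans)
      with Inr \<open>a \<in> _\<close> show ?thesis by blast
    qed
    then obtain y where y: "y \<in> carrier G <+> carrier H" "free_product_eq G H [y, x] []" by blast
    have vv: "free_product_eq G H v v" and uu: "free_product_eq G H u u"
      using v Cons by (auto intro: free_product_eq.refl)
    have "free_product_eq G H (v @ [y, x] @ u) (v @ [] @ u)"
      by (intro free_product_eq.append vv uu y)
    then have "free_product_eq G H ((v @ [y]) @ x # u) []"
      using free_product_eq.trans[OF _ v(2)] by simp
    moreover have "v @ [y] \<in> ?W" using v y by auto
    ultimately show ?case by blast
  qed
  show ?thesis
  proof (rule groupI)
    fix A assume "A \<in> carrier ?P"
    then obtain u where u: "u \<in> ?W" "A = ?R `` {u}" using repr by blast
    with inv obtain v where v: "v \<in> ?W" "free_product_eq G H (v @ u) []" by blast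
    show "\<exists>B\<in>carrier ?P. B \<otimes>\<^bsub>?P\<^esub> A = \<one>\<^bsub>?P\<^esub>"
      unfolding carr one u(2)
      using mult[OF v(1) u(1)] cls[OF v(2)] quotientI[OF v(1), of ?R] by metis
  next
    fix A B assume "A \<in> carrier ?P" "B \<in> carrier ?P"
    then obtain u v where uv: "u \<in> ?W" "A = ?R `` {u}" "v \<in> ?W" "B = ?R `` {v}" using repr by meson
    then have "u @ v \<in> ?W" by auto
    then show "A \<otimes>\<^bsub>?P\<^esub> B \<in> carrier ?P"
      unfolding uv(2,4) mult[OF uv(1,3)] carr by (rule quotientI)
  next
    fix A B C assume "A \<in> carrier ?P" "B \<in> carrier ?P" "C \<in> carrier ?P"
    then obtain u v w where uvw: "u \<in> ?W" "A = ?R `` {u}" "v \<in> ?W" "B = ?R `` {v}"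
      "w \<in> ?W" "C = ?R `` {w}" using repr by meson
    then have "u @ v \<in> ?W" "v @ w \<in> ?W" by auto
    then show "A \<otimes>\<^bsub>?P\<^esub> B \<otimes>\<^bsub>?P\<^esub> C = A \<otimes>\<^bsub>?P\<^esub> (B \<otimes>\<^bsub>?P\<^esub> C)"
      unfolding uvw(2,4,6) using uvw(1,3,5) by (metis mult append_assoc)
  next
    show "\<one>\<^bsub>?P\<^esub> \<in> carrier ?P" unfolding one carr by (rule quotientI) simp
  next
    fix A assume "A \<in> carrier ?P"
    then obtain u where u: "u \<in> ?W" "A = ?R `` {u}" using repr by blast
    show "\<one>\<^bsub>?P\<^esub> \<otimes>\<^bsub>?P\<^esub> A = A"
      unfolding one u(2) using mult[of "[]" u] u(1) by simp
  qed
qed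


section \<open>Highly transitive actions\<close>

definition injective_tuples :: "'a set \<Rightarrow> nat \<Rightarrow> 'a list set" where
  "injective_tuples X k = {xs. set xs \<subseteq> X \<and> length xs = k \<and> distinct xs}"

text \<open>The restriction makes the maps extensional, as required of elements of \<^const>\<open>BijGroup\<close>.\<close>

definition diagonal_action :: "'a set \<Rightarrow> ('g \<Rightarrow> 'a \<Rightarrow> 'a) \<Rightarrow> nat \<Rightarrow> 'g \<Rightarrow> 'a list \<Rightarrow> 'a list" where
  "diagonal_action X \<phi> k g = (\<lambda>xs\<in>injective_tuples X k. map (\<phi> g) xs)"

definition highly_transitive_action ::
    "('g, 'm) monoid_scheme \<Rightarrow> 'a set \<Rightarrow> ('g \<Rightarrow> 'a \<Rightarrow> 'a) \<Rightarrow> bool" where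
  "highly_transitive_action G X \<phi> \<longleftrightarrow>
    countable X \<and> infinite X \<and> group_action G X \<phi> \<and>
    (\<forall>k\<ge>1. transitive_action G (injective_tuples X k) (diagonal_action X \<phi> k))"

lemma group_action_diagonal_action:
  assumes "group_action G X \<phi>"
  shows "group_action G (injective_tuples X k) (diagonal_action X \<phi> k)"
proof -
  interpret group_action G X \<phi> by fact
  let ?T = "injective_tuples X k"
  let ?d = "diagonal_action X \<phi> k"
  interpret G: group G using group_hom group_hom.axioms(1) by blast
  have closed: "map (\<phi> g) xs \<in> ?T" if "g \<in> carrier G" "xs \<in> ?T" for g xs
  proof -
    have "inj_on (\<phi> g) X" using inj_prop[OF that(1)] .
    then have "inj_on (\<phi> g) (set xs)"
      using that(2) inj_on_subset by (auto simp: injective_tuples_def)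
    with that show ?thesis
      using element_image[OF that(1)] by (auto simp: injective_tuples_def distinct_map)
  qed
  have comp: "map (\<phi> (g \<otimes>\<^bsub>G\<^esub> h)) xs = map (\<phi> g) (map (\<phi> h) xs)"
    if "g \<in> carrier G" "h \<in> carrier G" "xs \<in> ?T" for g h xs
    using that composition_rule[OF _ that(1,2)] by (auto simp: injective_tuples_def)
  have one: "map (\<phi> \<one>\<^bsub>G\<^esub>) xs = xs" if "xs \<in> ?T" for xs
  proof -
    have "\<phi> \<one>\<^bsub>G\<^esub> x = x" if "x \<in> X" for x
      unfolding id_eq_one[symmetric] using that by simp
    with that show ?thesis by (auto simp: injective_tuples_def intro!: map_idI)
  qed
  have inv: "map (\<phi> g) (map (\<phi> (inv\<^bsub>G\<^esub> g)) xs) = xs" "map (\<phi> (inv\<^bsub>G\<^esub> g)) (map (\<phi> g) xs) = xs"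
    if "g \<in> carrier G" "xs \<in> ?T" for g xs
    using comp[of g "inv\<^bsub>G\<^esub> g" xs] comp[of "inv\<^bsub>G\<^esub> g" g xs] one[of xs] that by simp_all
  have bij: "?d g \<in> carrier (BijGroup ?T)" if "g \<in> carrier G" for g
  proof -
    have "bij_betw (?d g) ?T ?T"
      using that closed[OF that] closed[of "inv\<^bsub>G\<^esub> g"] inv[OF that]
      by (intro bij_betw_byWitness[where f' = "map (\<phi> (inv\<^bsub>G\<^esub> g))"])
         (auto simp: diagonal_action_def simp del: map_map)
    then show ?thesis
      by (simp add: BijGroup_def Bij_def diagonal_action_def)
  qed
  have "?d \<in> hom G (BijGroup ?T)"
  proof (rule homI)
    fix g h assume gh: "g \<in> carrier G" "h \<in> carrier G"
    have "?d (g \<otimes>\<^bsub>G\<^esub> h) = compose ?T (?d g) (?d h)"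
      unfolding diagonal_action_def compose_def
      by (rule restrict_ext) (simp add: comp[OF gh] closed[OF gh(2)] del: map_map)
    with bij[OF gh(1)] bij[OF gh(2)]
    show "?d (g \<otimes>\<^bsub>G\<^esub> h) = ?d g \<otimes>\<^bsub>BijGroup ?T\<^esub> ?d h"
      by (simp add: BijGroup_def)
  qed (rule bij)
  then show ?thesis
    by (intro group_action.intro group_hom.intro group_hom_axioms.intro G.is_group group_BijGroup)
qed

end

theory Submission
  imports Defs
begin

text \<open>The three positive claims rest on one normal form. In a group with elements \<open>s\<close>, \<open>u\<close> satisfying
  \<open>s\<^sup>2 = u\<^sup>3 = 1\<close>, every word in \<open>s\<close> and \<open>u\<close> equals some \<open>s\<^sup>j w u\<^sup>i\<close> with \<open>j < 2\<close>, \<open>i < 3\<close> and \<open>w\<close> a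
  product of factors \<open>us\<close> and \<open>u\<^sup>2s\<close>. Consequently a homomorphism from the free product of the cyclic
  groups of orders two and three is injective as soon as it kills no non-empty normal word
  (\<open>Z2_Z3_inj\<close>). Uniqueness of normal forms in the free product never has to be proved separately:
  it is a by-product of the existence of such homomorphisms.

  For the isomorphism, \<open>s\<close> and \<open>u\<close> go to integer matrices for which \<open>us\<close> and \<open>u\<^sup>2s\<close> are the two
  elementary unipotent matrices with non-negative entries. A product of these is non-negative, and
  this sign pattern keeps a non-empty normal word away from the identity and its negative
  (\<open>eval_normal_word\<close>). Surjectivity is the Euclidean algorithm on the first column
  (\<open>SL2Z_generated\<close>).

  For the action, \<open>u\<close> is the fixed permutation \<open>rot\<close> of the natural numbers that consists of 3-cycles,
  and \<open>s\<close> is built as a union of an increasing sequence of finite partial involutions. Each of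
  countably many requirements must be reachable from every admissible finite stage: that a given
  number lies in the domain, that some word carries a given tuple to another one, and that a given
  non-empty normal word moves some point. The requirement on tuples is the heart of the matter. All
  the points involved have to be brought, by one and the same word, to positions where \<open>s\<close> is not
  yet defined, because only there can it be prescribed freely. The invariant that makes this
  possible is that the partial injection \<open>us\<close> has no cycles. Then a high power of \<open>us\<close> leads every
  point along a chain out of the present domain. Turning off this chain at the last moment,
  with \<open>u\<^sup>2s\<close> in place of \<open>us\<close>, lands every point on a fresh undefined position, even if several points
  travel on the same chain (\<open>extend_to_escape\<close>). From there a few fresh 3-cycles suffice to join the
  two tuples (\<open>extend_to_connect_tuples\<close>).

  The action of \<open>SL2Z\<close> is the pullback of that of \<open>PSL2Z\<close>. It can never be faithful, since a central
  element acts trivially under an action that is transitive on pairs of distinct points of an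
  infinite set (\<open>central_acts_trivially\<close>), and the negative of the identity matrix is central.\<close>

section \<open>Words in a generator of order two and a generator of order three\<close>

text \<open>A word in the letters \<open>s\<close> (\<open>True\<close>) and \<open>u\<close> (\<open>False\<close>) stands for the product of its letters from left
  to right. Acting on points, it is therefore read from the right.\<close>

inductive_set pos_words :: "bool list set" where
  Nil: "[] \<in> pos_words"
| parabolic: "w \<in> pos_words \<Longrightarrow> False # True # w \<in> pos_words"
| antiparabolic: "w \<in> pos_words \<Longrightarrow> False # False # True # w \<in> pos_words"

definition normal_words :: "bool list set" where
  "normal_words = {v @ w @ replicate i False |v w i. v \<in> {[], [True]} \<and> w \<in> pos_words \<and> i < 3}"

text \<open>Only the leftmost occurrence of \<open>s\<close> is singled out. When the letters act one after the other, it is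
  the last use of the involution, so that the final position depends on it alone.\<close>

lemma normal_word_cases:
  assumes "u \<in> normal_words" "u \<noteq> []"
  obtains "u = [False]" | "u = [False, False]"
  | k w i where "k < 3" "w \<in> pos_words" "i < 3"
      "u = replicate k False @ True # w @ replicate i False"
proof -
  obtain v w i where u: "u = v @ w @ replicate i False" "v \<in> {[], [True]}" "w \<in> pos_words" "i < 3"
    using assms(1) unfolding normal_words_def by blast
  show thesis
  proof (cases "v = []")
    case True
    from u(3) show thesis
    proof cases
      case Nil
      have "i = 0 \<or> i = 1 \<or> i = 2" using u(4) by linarith
      then show thesis using that(1,2) True Nil u assms(2) by (auto simp: numeral_2_eq_2)
    next
      case (parabolic w')
      then show thesis using that(3)[of 1 w' i] True u by simp
    next
      case (antiparabolic w')
      then show thesis using that(3)[of 2 w' i] True u by (simp add: numeral_2_eq_2)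
    qed
  next
    case False
    then show thesis using that(3)[of 0 w i] u by simp
  qed
qed

definition eval_word :: "('g, 'm) monoid_scheme \<Rightarrow> 'g \<Rightarrow> 'g \<Rightarrow> bool list \<Rightarrow> 'g" where
  "eval_word K s u w = foldr (\<lambda>c g. (if c then s else u) \<otimes>\<^bsub>K\<^esub> g) w \<one>\<^bsub>K\<^esub>"

lemma eval_word_Nil [simp]: "eval_word K s u [] = \<one>\<^bsub>K\<^esub>"
  and eval_word_Cons [simp]: "eval_word K s u (c # w) = (if c then s else u) \<otimes>\<^bsub>K\<^esub> eval_word K s u w"
  by (simp_all add: eval_word_def)

text \<open>The letters of a word are absorbed into a normal form one by one from the left. A letter \<open>s\<close> cancels or
  creates the initial \<open>s\<close>. A letter \<open>u\<close> turns an initial \<open>s\<close> into a factor \<open>us\<close>, an initial \<open>us\<close> into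
  \<open>u\<^sup>2s\<close>, and an initial \<open>u\<^sup>2s\<close> into \<open>s\<close>.\<close>

context group
begin

lemma eval_word_closed [simp]: "s \<in> carrier G \<Longrightarrow> u \<in> carrier G \<Longrightarrow> eval_word G s u w \<in> carrier G"
  by (induction w) simp_all

lemma eval_word_append:
  "s \<in> carrier G \<Longrightarrow> u \<in> carrier G \<Longrightarrow> eval_word G s u (v @ w) = eval_word G s u v \<otimes> eval_word G s u w"
  by (induction v) (simp_all add: m_assoc)

lemma eval_word_normal_form:
  assumes "s \<in> carrier G" "u \<in> carrier G" "s \<otimes> s = \<one>" "u \<otimes> (u \<otimes> u) = \<one>"
  shows "\<exists>w'\<in>normal_words. eval_word G s u w' = eval_word G s u w"
proof (induction w)
  case Nil
  have "[] \<in> normal_words" using pos_words.Nil unfolding normal_words_def by force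
  then show ?case by blast
next
  case (Cons c w)
  then obtain v p i where vpi: "v \<in> {[], [True]}" "p \<in> pos_words" "i < 3"
    and IH: "eval_word G s u w = eval_word G s u (v @ p @ replicate i False)"
    unfolding normal_words_def by force
  have nf: "v @ q @ replicate j False \<in> normal_words"
    if "v \<in> {[], [True]}" "q \<in> pos_words" "j < 3" for v q j
    using that unfolding normal_words_def by blast
  have ss: "s \<otimes> (s \<otimes> x) = x" and uuu: "u \<otimes> (u \<otimes> (u \<otimes> x)) = x" if "x \<in> carrier G" for x
    using assms that by (metis l_one m_assoc m_closed)+
  show ?case
  proof (cases c)
    case True
    show ?thesis
    proof (cases "v = []")
      case True
      then show ?thesis using nf[of "[True]" p i] vpi IH \<open>c\<close> by (intro bexI[of _ "[True] @ p @ replicate i False"]) simp_all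
    next
      case False
      then show ?thesis using nf[of "[]" p i] vpi IH \<open>c\<close> ss assms by (intro bexI[of _ "[] @ p @ replicate i False"]) simp_all
    qed
  next
    case c: False
    show ?thesis
    proof (cases "v = []")
      case False
      then show ?thesis
        using nf[of "[]" "False # True # p" i] pos_words.parabolic[OF vpi(2)] vpi IH c
        by (intro bexI[of _ "[] @ (False # True # p) @ replicate i False"]) simp_all
    next
      case v: True
      from vpi(2) show ?thesis
      proof cases
        case Nil
        show ?thesis
        proof (cases "i = 2")
          case True
          then show ?thesis using nf[of "[]" "[]" 0] pos_words.Nil v c IH Nil assms
            by (intro bexI[of _ "[] @ [] @ replicate 0 False"]) (simp_all add: numeral_2_eq_2)
        next
          case False
          then show ?thesis using nf[of "[]" "[]" "Suc i"] pos_words.Nil v c IH Nil vpi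
            by (intro bexI[of _ "[] @ [] @ replicate (Suc i) False"]) simp_all
        qed
      next
        case (parabolic q)
        then show ?thesis
          using nf[of "[]" "False # False # True # q" i] pos_words.antiparabolic[of q] vpi IH c v
          by (intro bexI[of _ "[] @ (False # False # True # q) @ replicate i False"]) simp_all
      next
        case (antiparabolic q)
        then show ?thesis
          using nf[of "[True]" q i] vpi IH c v uuu assms
          by (intro bexI[of _ "[True] @ q @ replicate i False"]) simp_all
      qed
    qed
  qed
qed

end

lemma hom_eval_word:
  assumes "group G" "group K" "h \<in> hom G K" "s \<in> carrier G" "u \<in> carrier G"
  shows "h (eval_word G s u w) = eval_word K (h s) (h u) w"
proof -
  interpret group_hom G K h using assms by (simp add: group_hom_def group_hom_axioms_def)
  show ?thesis using assms(4,5) by (induction w) simp_all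
qed

section \<open>The free product of the cyclic groups of orders two and three\<close>

definition word_class ::
    "('a, 'c) monoid_scheme \<Rightarrow> ('b, 'd) monoid_scheme \<Rightarrow> ('a + 'b) list \<Rightarrow> ('a + 'b) list set" where
  "word_class G H w = {(u, v). free_product_eq G H u v} `` {w}"

text \<open>The induced map evaluates a representative of a class letter by letter. Evaluation respects the
  defining congruence because \<open>f\<close> and \<open>g\<close> are homomorphisms, so the choice of the representative is
  irrelevant.\<close>

lemma free_product_universal:
  assumes "group G" "group H" "group K" "f \<in> hom G K" "g \<in> hom H K"
  obtains h where "h \<in> hom (free_product G H) K"
    "\<And>x. x \<in> carrier G \<Longrightarrow> h (word_class G H [Inl x]) = f x"
    "\<And>y. y \<in> carrier H \<Longrightarrow> h (word_class G H [Inr y]) = g y"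
proof -
  interpret f: group_hom G K f using assms by (simp add: group_hom_def group_hom_axioms_def)
  interpret g: group_hom H K g using assms by (simp add: group_hom_def group_hom_axioms_def)
  let ?W = "lists (carrier G <+> carrier H)"
  let ?F = "free_product G H"
  define val where "val w = foldr (\<lambda>x k. case_sum f g x \<otimes>\<^bsub>K\<^esub> k) w \<one>\<^bsub>K\<^esub>" for w
  have val_simps [simp]: "val [] = \<one>\<^bsub>K\<^esub>" "val (x # w) = case_sum f g x \<otimes>\<^bsub>K\<^esub> val w" for x w
    by (simp_all add: val_def)
  have val_closed: "val w \<in> carrier K" if "w \<in> ?W" for w
    using that by (induction w) auto
  have val_append: "val (v @ w) = val v \<otimes>\<^bsub>K\<^esub> val w" if "v \<in> ?W" "w \<in> ?W" for v w
    using that(1)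
  proof (induction v)
    case (Cons x v)
    then show ?case using val_closed[OF Cons.hyps(2)] val_closed[OF that(2)] by (auto simp: f.H.m_assoc)
  qed (use val_closed[OF that(2)] in simp)
  have val_cong: "val v = val w" if "free_product_eq G H v w" for v w
    using that
  proof induction
    case (append u u' v v')
    then show ?case
      using free_product_eq_in_words[OF assms(1,2)] val_append by metis
  qed (simp_all add: f.H.m_assoc)
  define h where "h A = val (SOME w. w \<in> A)" for A
  have h: "h (word_class G H w) = val w" if "w \<in> ?W" for w
  proof -
    have "w \<in> word_class G H w" using that by (simp add: word_class_def free_product_eq.refl)
    then have "(SOME v. v \<in> word_class G H w) \<in> word_class G H w" by (rule someI)
    then show ?thesis using val_cong[of w] unfolding h_def by (simp add: word_class_def)
  qed
  have carr: "\<exists>w\<in>?W. A = word_class G H w" if "A \<in> carrier ?F" for A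
    using that by (auto simp: word_class_def free_product_def Let_def quotient_def)
  have "h \<in> hom ?F K"
  proof (rule homI)
    fix A assume "A \<in> carrier ?F"
    then show "h A \<in> carrier K" using carr h val_closed by metis
  next
    fix A B assume "A \<in> carrier ?F" "B \<in> carrier ?F"
    then obtain v w where vw: "v \<in> ?W" "w \<in> ?W" "A = word_class G H v" "B = word_class G H w"
      using carr by meson
    then have "v @ w \<in> ?W" by simp
    then show "h (A \<otimes>\<^bsub>?F\<^esub> B) = h A \<otimes>\<^bsub>K\<^esub> h B"
      unfolding vw(3,4) mult_free_product[OF assms(1,2) vw(1,2), folded word_class_def] using h vw val_append by metis
  qed
  moreover have "h (word_class G H [Inl x]) = f x" if "x \<in> carrier G" for x
    using h[of "[Inl x]"] that by (simp add: InlI)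
  moreover have "h (word_class G H [Inr y]) = g y" if "y \<in> carrier H" for y
    using h[of "[Inr y]"] that by (simp add: InrI)
  ultimately show thesis by (rule that)
qed

abbreviation Z2_Z3 :: "(int + int) list set monoid" where
  "Z2_Z3 \<equiv> free_product (integer_mod_group 2) (integer_mod_group 3)"

abbreviation Z2_Z3_class :: "(int + int) list \<Rightarrow> (int + int) list set" where
  "Z2_Z3_class \<equiv> word_class (integer_mod_group 2) (integer_mod_group 3)"

abbreviation gen2 :: "(int + int) list set" where
  "gen2 \<equiv> Z2_Z3_class [Inl 1]"

abbreviation gen3 :: "(int + int) list set" where
  "gen3 \<equiv> Z2_Z3_class [Inr 1]"

lemma group_Z2_Z3: "group Z2_Z3"
  by (rule group_free_product) simp_all

lemma carrier_Z2: "carrier (integer_mod_group 2) = {0, 1}"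
  and carrier_Z3: "carrier (integer_mod_group 3) = {0, 1, 2}"
  by (auto simp: carrier_integer_mod_group)

lemma Z2_Z3_class_mult:
  assumes "v \<in> lists ({0, 1} <+> {0, 1, 2})" "w \<in> lists ({0, 1} <+> {0, 1, 2})"
  shows "Z2_Z3_class v \<otimes>\<^bsub>Z2_Z3\<^esub> Z2_Z3_class w = Z2_Z3_class (v @ w)"
  using mult_free_product[of "integer_mod_group 2" "integer_mod_group 3" v w] assms
  by (simp add: carrier_Z2 carrier_Z3 word_class_def)

lemma Z2_Z3_class_eq:
  assumes "free_product_eq (integer_mod_group 2) (integer_mod_group 3) v w"
  shows "Z2_Z3_class v = Z2_Z3_class w"
  using equiv_class_eq[OF equiv_free_product_eq[of "integer_mod_group 2" "integer_mod_group 3"]] assms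
  by (simp add: word_class_def)

lemma one_Z2_Z3: "\<one>\<^bsub>Z2_Z3\<^esub> = Z2_Z3_class []"
  by (simp add: word_class_def free_product_def Let_def)

lemma carrier_Z2_Z3: "carrier Z2_Z3 = Z2_Z3_class ` lists ({0, 1} <+> {0, 1, 2})"
  by (auto simp: word_class_def free_product_def Let_def quotient_def carrier_Z2 carrier_Z3)

lemma gens_in_Z2_Z3 [simp]: "gen2 \<in> carrier Z2_Z3" "gen3 \<in> carrier Z2_Z3"
  unfolding carrier_Z2_Z3 by (intro imageI; auto)+

lemma Z2_Z3_classes:
  "Z2_Z3_class [Inl 0] = \<one>\<^bsub>Z2_Z3\<^esub>" "Z2_Z3_class [Inr 0] = \<one>\<^bsub>Z2_Z3\<^esub>"
  "Z2_Z3_class [Inr 2] = gen3 \<otimes>\<^bsub>Z2_Z3\<^esub> gen3"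
  "gen2 \<otimes>\<^bsub>Z2_Z3\<^esub> gen2 = \<one>\<^bsub>Z2_Z3\<^esub>"
  "gen3 \<otimes>\<^bsub>Z2_Z3\<^esub> (gen3 \<otimes>\<^bsub>Z2_Z3\<^esub> gen3) = \<one>\<^bsub>Z2_Z3\<^esub>"
proof -
  let ?eq = "free_product_eq (integer_mod_group 2) (integer_mod_group 3)"
  have letters: "[Inl 1] \<in> lists ({0, 1} <+> {0, 1, 2})" "[Inr 1] \<in> lists ({0, 1} <+> {0, 1, 2})"
    "[Inr 2] \<in> lists ({0, 1} <+> {0, 1, 2})" by auto
  have "?eq [Inl 0] []" "?eq [Inr 0] []"
    using free_product_eq.one_left[of "integer_mod_group 2" "integer_mod_group 3"]
      free_product_eq.one_right[of "integer_mod_group 2" "integer_mod_group 3"] by simp_all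
  from this[THEN Z2_Z3_class_eq]
  show l0: "Z2_Z3_class [Inl 0] = \<one>\<^bsub>Z2_Z3\<^esub>" and r0: "Z2_Z3_class [Inr 0] = \<one>\<^bsub>Z2_Z3\<^esub>"
    by (simp_all add: one_Z2_Z3)
  have "?eq [Inl 1, Inl 1] [Inl 0]"
    using free_product_eq.mult_left[of 1 "integer_mod_group 2" 1 "integer_mod_group 3"]
    by (simp add: carrier_Z2)
  from Z2_Z3_class_eq[OF this] show "gen2 \<otimes>\<^bsub>Z2_Z3\<^esub> gen2 = \<one>\<^bsub>Z2_Z3\<^esub>"
    using Z2_Z3_class_mult[OF letters(1) letters(1)] by (simp add: l0)
  have "?eq [Inr 1, Inr 1] [Inr 2]"
    using free_product_eq.mult_right[of 1 "integer_mod_group 3" 1 "integer_mod_group 2"]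
    by (simp add: carrier_Z3)
  from Z2_Z3_class_eq[OF this] show r2: "Z2_Z3_class [Inr 2] = gen3 \<otimes>\<^bsub>Z2_Z3\<^esub> gen3"
    using Z2_Z3_class_mult[OF letters(2) letters(2)] by simp
  have "?eq [Inr 1, Inr 2] [Inr 0]"
    using free_product_eq.mult_right[of 1 "integer_mod_group 3" 2 "integer_mod_group 2"]
    by (simp add: carrier_Z3)
  from Z2_Z3_class_eq[OF this] show "gen3 \<otimes>\<^bsub>Z2_Z3\<^esub> (gen3 \<otimes>\<^bsub>Z2_Z3\<^esub> gen3) = \<one>\<^bsub>Z2_Z3\<^esub>"
    using Z2_Z3_class_mult[OF letters(2) letters(3)] by (simp add: r0 r2)
qed

lemma Z2_Z3_generated:
  assumes "A \<in> carrier Z2_Z3"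
  shows "\<exists>w. A = eval_word Z2_Z3 gen2 gen3 w"
proof -
  interpret group Z2_Z3 by (rule group_Z2_Z3)
  have letter: "\<exists>w. Z2_Z3_class [x] = eval_word Z2_Z3 gen2 gen3 w" if "x \<in> {0, 1} <+> {0, 1, 2}" for x
  proof -
    have "Z2_Z3_class [Inl 0] = eval_word Z2_Z3 gen2 gen3 []"
      "gen2 = eval_word Z2_Z3 gen2 gen3 [True]"
      "Z2_Z3_class [Inr 0] = eval_word Z2_Z3 gen2 gen3 []"
      "gen3 = eval_word Z2_Z3 gen2 gen3 [False]"
      "Z2_Z3_class [Inr 2] = eval_word Z2_Z3 gen2 gen3 [False, False]"
      by (simp_all add: Z2_Z3_classes(1,2,3))
    with that show ?thesis by blast
  qed
  have "\<exists>w. Z2_Z3_class v = eval_word Z2_Z3 gen2 gen3 w" if "v \<in> lists ({0, 1} <+> {0, 1, 2})" for v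
    using that
  proof (induction v)
    case Nil
    have "Z2_Z3_class [] = eval_word Z2_Z3 gen2 gen3 []" by (simp add: one_Z2_Z3)
    then show ?case by blast
  next
    case (Cons x v)
    obtain w where w: "Z2_Z3_class [x] = eval_word Z2_Z3 gen2 gen3 w"
      using letter[OF Cons.hyps(1)] ..
    obtain w' where w': "Z2_Z3_class v = eval_word Z2_Z3 gen2 gen3 w'"
      using Cons.IH ..
    have "Z2_Z3_class (x # v) = Z2_Z3_class [x] \<otimes>\<^bsub>Z2_Z3\<^esub> Z2_Z3_class v"
      using Z2_Z3_class_mult[of "[x]" v] Cons.hyps by simp
    also have "\<dots> = eval_word Z2_Z3 gen2 gen3 (w @ w')"
      unfolding w w' eval_word_append[OF gens_in_Z2_Z3] ..
    finally show ?case by blast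
  qed
  with assms show ?thesis unfolding carrier_Z2_Z3 by blast
qed

lemma Z2_Z3_lift:
  assumes "group K" "s \<in> carrier K" "u \<in> carrier K"
    and "s \<otimes>\<^bsub>K\<^esub> s = \<one>\<^bsub>K\<^esub>" "u \<otimes>\<^bsub>K\<^esub> (u \<otimes>\<^bsub>K\<^esub> u) = \<one>\<^bsub>K\<^esub>"
  obtains h where "h \<in> hom Z2_Z3 K" "h gen2 = s" "h gen3 = u"
proof -
  interpret group K by fact
  define f where "f a = (if a = 0 then \<one>\<^bsub>K\<^esub> else s)" for a :: int
  define g where "g a = (if a = 0 then \<one>\<^bsub>K\<^esub> else if a = 1 then u else u \<otimes>\<^bsub>K\<^esub> u)" for a :: int
  have "f \<in> hom (integer_mod_group 2) K"
    by (rule homI) (use assms in \<open>auto simp: carrier_Z2 f_def\<close>)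
  moreover have "g \<in> hom (integer_mod_group 3) K"
    by (rule homI) (use assms in \<open>auto simp: carrier_Z3 g_def m_assoc\<close>)
  ultimately obtain h where "h \<in> hom Z2_Z3 K"
    "\<And>x. x \<in> carrier (integer_mod_group 2) \<Longrightarrow> h (Z2_Z3_class [Inl x]) = f x"
    "\<And>x. x \<in> carrier (integer_mod_group 3) \<Longrightarrow> h (Z2_Z3_class [Inr x]) = g x"
    using free_product_universal[OF group_integer_mod_group group_integer_mod_group assms(1)] by metis
  then show thesis by (intro that[of h]) (simp_all add: f_def g_def)
qed

text \<open>An element of the kernel can be written as a normal word, and by hypothesis only the empty one is
  killed.\<close>

lemma Z2_Z3_inj:
  assumes "group K" "h \<in> hom Z2_Z3 K"
    and "\<And>w. w \<in> normal_words \<Longrightarrow> w \<noteq> [] \<Longrightarrow> eval_word K (h gen2) (h gen3) w \<noteq> \<one>\<^bsub>K\<^esub>"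
  shows "inj_on h (carrier Z2_Z3)"
proof -
  interpret group_hom Z2_Z3 K h
    using assms group_Z2_Z3 by (simp add: group_hom_def group_hom_axioms_def)
  have "A = \<one>\<^bsub>Z2_Z3\<^esub>" if A: "A \<in> carrier Z2_Z3" "h A = \<one>\<^bsub>K\<^esub>" for A
  proof -
    obtain w where w: "w \<in> normal_words" "A = eval_word Z2_Z3 gen2 gen3 w"
      using Z2_Z3_generated[OF A(1)] G.eval_word_normal_form[OF gens_in_Z2_Z3 Z2_Z3_classes(4,5)] by metis
    then have "h A = eval_word K (h gen2) (h gen3) w"
      using hom_eval_word[OF group_Z2_Z3 assms(1,2) gens_in_Z2_Z3] by simp
    with A(2) w assms(3) have "w = []" by metis
    with w(2) show ?thesis by simp
  qed
  then show ?thesis unfolding inj_on_one_iff by blast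
qed

section \<open>The modular group as a free product\<close>

definition mat22 :: "int \<Rightarrow> int \<Rightarrow> int \<Rightarrow> int \<Rightarrow> int^2^2" where
  "mat22 a b c d = (\<chi> i j. if i = 1 then (if j = 1 then a else b) else (if j = 1 then c else d))"

lemma mat22_nth [simp]:
  "mat22 a b c d $ 1 $ 1 = a" "mat22 a b c d $ 1 $ 2 = b"
  "mat22 a b c d $ 2 $ 1 = c" "mat22 a b c d $ 2 $ 2 = d"
  by (simp_all add: mat22_def)

lemma mat22_mult [simp]:
  "mat22 a b c d ** mat22 a' b' c' d' =
    mat22 (a * a' + b * c') (a * b' + b * d') (c * a' + d * c') (c * b' + d * d')"
  by (simp add: vec_eq_iff matrix_matrix_mult_def forall_2 sum_2)

lemma mat22_eq_iff [simp]:
  "mat22 a b c d = mat22 a' b' c' d' \<longleftrightarrow> a = a' \<and> b = b' \<and> c = c' \<and> d = d'"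
  by (auto simp: vec_eq_iff forall_2)

lemma mat_1_eq: "mat 1 = mat22 1 0 0 1"
  by (simp add: vec_eq_iff forall_2 mat_def)

lemma uminus_mat22 [simp]: "- mat22 a b c d = mat22 (- a) (- b) (- c) (- d)"
  by (simp add: vec_eq_iff forall_2)

lemma mat22_exhaust: obtains a b c d where "A = mat22 a b c d"
proof
  show "A = mat22 (A $ 1 $ 1) (A $ 1 $ 2) (A $ 2 $ 1) (A $ 2 $ 2)"
    by (simp add: vec_eq_iff forall_2)
qed

lemma mat22_in_SL2Z [simp]: "mat22 a b c d \<in> carrier SL2Z \<longleftrightarrow> a * d - b * c = 1"
  by (simp add: SL2Z_def det_2)

lemma mult_SL2Z [simp]: "A \<otimes>\<^bsub>SL2Z\<^esub> B = A ** B"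
  and one_SL2Z: "\<one>\<^bsub>SL2Z\<^esub> = mat22 1 0 0 1"
  by (simp_all add: SL2Z_def mat_1_eq)

text \<open>Among the possible choices of generators, this one makes \<open>matU ** matS\<close> and
  \<open>matU ** matU ** matS\<close> the lower and the upper elementary unipotent matrix, with no sign. As matrices,
  \<open>matS\<close> and \<open>matU\<close> have orders 4 and 6. Their square and cube, respectively, equal the negative of
  the identity.\<close>

abbreviation matS :: "int^2^2" where "matS \<equiv> mat22 0 (-1) 1 0"
abbreviation matU :: "int^2^2" where "matU \<equiv> mat22 0 1 (-1) 1"

text \<open>Multiplication by an elementary unipotent matrix adds one row to the other, which preserves this sign
  pattern and, thanks to the positive diagonal, makes an off-diagonal entry positive.\<close>

lemma eval_pos_word:
  assumes "w \<in> pos_words"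
  shows "\<exists>p q r t. eval_word SL2Z matS matU w = mat22 p q r t \<and>
    1 \<le> p \<and> 1 \<le> t \<and> 0 \<le> q \<and> 0 \<le> r \<and> (w \<noteq> [] \<longrightarrow> 1 \<le> q + r)"
  using assms
proof induction
  case Nil
  then show ?case by (intro exI[of _ 1] exI[of _ 0]) (simp add: one_SL2Z)
next
  case (parabolic w)
  then obtain p q r t where "eval_word SL2Z matS matU w = mat22 p q r t"
    "1 \<le> p" "1 \<le> t" "0 \<le> q" "0 \<le> r" by blast
  then show ?case
    by (intro exI[of _ p] exI[of _ q] exI[of _ "p + r"] exI[of _ "q + t"]) simp
next
  case (antiparabolic w)
  then obtain p q r t where "eval_word SL2Z matS matU w = mat22 p q r t"
    "1 \<le> p" "1 \<le> t" "0 \<le> q" "0 \<le> r" by blast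
  then show ?case
    by (intro exI[of _ "p + r"] exI[of _ "q + t"] exI[of _ r] exI[of _ t]) simp
qed

text \<open>Both the identity and its negative are diagonal. By the sign pattern of \<open>eval_pos_word\<close>, each of the six
  choices for the outer letters \<open>s\<^sup>j\<close> and \<open>u\<^sup>i\<close> produces a non-zero off-diagonal entry. Without outer letters
  this is where the last clause of that pattern enters.\<close>

lemma eval_normal_word:
  assumes "w \<in> normal_words" "w \<noteq> []"
  shows "eval_word SL2Z matS matU w \<notin> {mat 1, - mat 1}"
proof -
  interpret group SL2Z by (rule group_SL2Z)
  obtain v p i where w: "w = v @ p @ replicate i False" "v \<in> {[], [True]}" "p \<in> pos_words" "i < 3"
    using assms(1) unfolding normal_words_def by blast
  obtain a b c d where abcd: "eval_word SL2Z matS matU p = mat22 a b c d"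
    "1 \<le> a" "1 \<le> d" "0 \<le> b" "0 \<le> c" "p \<noteq> [] \<longrightarrow> 1 \<le> b + c"
    using eval_pos_word[OF w(3)] by blast
  let ?M = "eval_word SL2Z matS matU w"
  have ne: "v = [] \<and> i = 0 \<longrightarrow> 1 \<le> b + c" using abcd(6) assms(2) w(1) by auto
  have M: "?M = eval_word SL2Z matS matU v **
      (mat22 a b c d ** eval_word SL2Z matS matU (replicate i False))"
    using abcd(1) by (simp add: w(1) eval_word_append)
  have "i = 0 \<or> i = 1 \<or> i = 2" "v = [] \<or> v = [True]" using w(2,4) by auto
  then have "?M $ 1 $ 2 \<noteq> 0 \<or> ?M $ 2 $ 1 \<noteq> 0"
    using ne abcd(2-5) unfolding M
    by (elim disjE) (simp_all add: one_SL2Z numeral_2_eq_2)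
  then show ?thesis by (auto simp: mat_def)
qed

text \<open>Induction on the absolute value of the lower left entry: a row operation by a power of the upper
  unipotent matrix reduces the upper left entry modulo the lower left one, and \<open>matS\<close> swaps the rows.
  The inverses of the generators are words in the generators, since both have finite order.\<close>

lemma SL2Z_generated:
  assumes "A \<in> carrier SL2Z"
  shows "\<exists>w. A = eval_word SL2Z matS matU w"
proof -
  interpret group SL2Z by (rule group_SL2Z)
  define H where "H = range (eval_word SL2Z matS matU)"
  have mult: "A ** B \<in> H" if AB: "A \<in> H" "B \<in> H" for A B
  proof -
    obtain v w where "A = eval_word SL2Z matS matU v" "B = eval_word SL2Z matS matU w"
      using AB unfolding H_def by blast
    then have "A ** B = eval_word SL2Z matS matU (v @ w)" by (simp add: eval_word_append)
    then show ?thesis unfolding H_def by blast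
  qed
  have ev: "eval_word SL2Z matS matU w \<in> H" for w unfolding H_def by blast
  have S: "matS \<in> H" and I: "mat22 (-1) 0 0 (-1) \<in> H"
    and T: "mat22 1 1 0 1 \<in> H" and T': "mat22 1 (-1) 0 1 \<in> H"
    using ev[of "[True]"] ev[of "[True, True]"] ev[of "[False, False, True]"]
      ev[of "[True, True, True, False, False, False, False]"]
    by (simp_all add: one_SL2Z)
  have Tn: "mat22 1 (int n) 0 1 \<in> H \<and> mat22 1 (- int n) 0 1 \<in> H" for n
  proof (induction n)
    case 0
    then show ?case using ev[of "[]"] by (simp add: one_SL2Z)
  next
    case (Suc n)
    then show ?case using mult[OF T, of "mat22 1 (int n) 0 1"] mult[OF T', of "mat22 1 (- int n) 0 1"]
      by (simp add: algebra_simps)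
  qed
  have Tk: "mat22 1 k 0 1 \<in> H" for k
    using Tn[of "nat \<bar>k\<bar>"] by (cases "k \<ge> 0") simp_all
  have "mat22 a b c d \<in> H" if "a * d - b * c = 1" for a b c d
    using that
  proof (induction "nat \<bar>c\<bar>" arbitrary: a b c d rule: less_induct)
    case less
    show ?case
    proof (cases "c = 0")
      case True
      then have "a * d = 1" using less.prems by simp
      then consider "a = 1" "d = 1" | "a = -1" "d = -1" using zmult_eq_1_iff by auto
      then show ?thesis
      proof cases
        case 1
        then show ?thesis using Tk True by simp
      next
        case 2
        then show ?thesis using mult[OF I Tk[of "- b"]] True by simp
      qed
    next
      case False
      define q where "q = a div c"
      have "nat \<bar>- (a - q * c)\<bar> < nat \<bar>c\<bar>"
        using False abs_mod_less[of c a] by (simp add: q_def minus_div_mult_eq_mod)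
      moreover have "c * - (b - q * d) - d * - (a - q * c) = 1"
        using less.prems by (simp add: algebra_simps)
      ultimately have "mat22 c d (- (a - q * c)) (- (b - q * d)) \<in> H"
        by (rule less.hyps)
      from mult[OF mult[OF Tk[of q] S] this] show ?thesis by simp
    qed
  qed
  with assms have "A \<in> H" by (cases A rule: mat22_exhaust) simp
  then show ?thesis unfolding H_def by blast
qed

definition proj :: "int^2^2 \<Rightarrow> (int^2^2) set" where
  "proj A = {mat 1, - mat 1} #>\<^bsub>SL2Z\<^esub> A"

lemma proj_hom: "proj \<in> hom SL2Z PSL2Z"
  using normal.r_coset_hom_Mod[OF normal_pm_one] unfolding proj_def[abs_def] PSL2Z_def .

lemma proj_surj: "proj ` carrier SL2Z = carrier PSL2Z"
  by (simp add: PSL2Z_def carrier_FactGroup proj_def[abs_def])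

lemma proj_eq_one_iff:
  assumes "A \<in> carrier SL2Z"
  shows "proj A = \<one>\<^bsub>PSL2Z\<^esub> \<longleftrightarrow> A \<in> {mat 1, - mat 1}"
proof -
  interpret group SL2Z by (rule group_SL2Z)
  have sub: "subgroup {mat 1, - mat 1} SL2Z" using normal_pm_one by (rule normal_imp_subgroup)
  have "A \<in> proj A" unfolding proj_def by (rule rcos_self[OF assms sub])
  moreover have "proj A = {mat 1, - mat 1}" if "A \<in> {mat 1, - mat 1}"
    unfolding proj_def by (rule coset_join2[OF assms sub that])
  ultimately show ?thesis by (auto simp: PSL2Z_def)
qed

lemma PSL2Z_iso:
  obtains h where "h \<in> iso Z2_Z3 PSL2Z"
proof -
  interpret S: group SL2Z by (rule group_SL2Z)
  interpret P: group PSL2Z by (rule group_PSL2Z)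
  interpret proj: group_hom SL2Z PSL2Z proj
    using proj_hom by (simp add: group_hom_def group_hom_axioms_def S.is_group P.is_group)
  have SU: "matS \<in> carrier SL2Z" "matU \<in> carrier SL2Z" by simp_all
  have "proj (matS \<otimes>\<^bsub>SL2Z\<^esub> matS) = \<one>\<^bsub>PSL2Z\<^esub>" "proj (matU \<otimes>\<^bsub>SL2Z\<^esub> (matU \<otimes>\<^bsub>SL2Z\<^esub> matU)) = \<one>\<^bsub>PSL2Z\<^esub>"
    by (subst proj_eq_one_iff; simp add: mat_1_eq)+
  then have rel: "proj matS \<otimes>\<^bsub>PSL2Z\<^esub> proj matS = \<one>\<^bsub>PSL2Z\<^esub>"
    "proj matU \<otimes>\<^bsub>PSL2Z\<^esub> (proj matU \<otimes>\<^bsub>PSL2Z\<^esub> proj matU) = \<one>\<^bsub>PSL2Z\<^esub>"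
    by (simp_all only: proj.hom_mult SU S.m_closed)
  have car: "proj matS \<in> carrier PSL2Z" "proj matU \<in> carrier PSL2Z"
    using SU by (simp_all only: proj.hom_closed)
  obtain h where h: "h \<in> hom Z2_Z3 PSL2Z" "h gen2 = proj matS" "h gen3 = proj matU"
    using Z2_Z3_lift[OF group_PSL2Z car rel] .
  have ev: "eval_word PSL2Z (proj matS) (proj matU) w = proj (eval_word SL2Z matS matU w)" for w
    using hom_eval_word[OF group_SL2Z group_PSL2Z proj_hom SU] by simp
  have ev': "eval_word PSL2Z (proj matS) (proj matU) w = h (eval_word Z2_Z3 gen2 gen3 w)" for w
    using hom_eval_word[OF group_Z2_Z3 group_PSL2Z h(1) gens_in_Z2_Z3] h(2,3) by simp
  have "inj_on h (carrier Z2_Z3)"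
  proof (rule Z2_Z3_inj[OF group_PSL2Z h(1)])
    fix w assume "w \<in> normal_words" "w \<noteq> []"
    then show "eval_word PSL2Z (h gen2) (h gen3) w \<noteq> \<one>\<^bsub>PSL2Z\<^esub>"
      using eval_normal_word[of w] proj_eq_one_iff[OF S.eval_word_closed[OF SU]]
      unfolding h(2,3) ev by simp
  qed
  moreover have "h ` carrier Z2_Z3 = carrier PSL2Z"
  proof
    show "h ` carrier Z2_Z3 \<subseteq> carrier PSL2Z" using h(1) by (auto simp: hom_def)
    show "carrier PSL2Z \<subseteq> h ` carrier Z2_Z3"
    proof
      fix x assume "x \<in> carrier PSL2Z"
      then obtain A where "A \<in> carrier SL2Z" "x = proj A" unfolding proj_surj[symmetric] by blast
      then obtain w where "x = proj (eval_word SL2Z matS matU w)" using SL2Z_generated by blast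
      then have "x = h (eval_word Z2_Z3 gen2 gen3 w)" using ev ev' by metis
      moreover have "eval_word Z2_Z3 gen2 gen3 w \<in> carrier Z2_Z3"
        by (rule group.eval_word_closed[OF group_Z2_Z3 gens_in_Z2_Z3])
      ultimately show "x \<in> h ` carrier Z2_Z3" by blast
    qed
  qed
  ultimately show thesis using h(1) by (intro that[of h]) (simp add: iso_def bij_betw_def)
qed

section \<open>Finite partial involutions\<close>

text \<open>The generator of order three acts by the 3-cycles \<open>(3k, 3k+1, 3k+2)\<close>.\<close>

definition rot :: "nat \<Rightarrow> nat" where
  "rot n = (if n mod 3 = 2 then n - 2 else n + 1)"

lemma rot_mult [simp]: "rot (3 * k) = 3 * k + 1" "rot (Suc (3 * k)) = 3 * k + 2"
    "rot (Suc (Suc (3 * k))) = 3 * k"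
proof -
  have "3 * k mod 3 = 0" "Suc (3 * k) mod 3 = 1" "Suc (Suc (3 * k)) mod 3 = 2" by presburger+
  then show "rot (3 * k) = 3 * k + 1" "rot (Suc (3 * k)) = 3 * k + 2"
    "rot (Suc (Suc (3 * k))) = 3 * k" by (simp_all add: rot_def)
qed

lemma mod_3_cases:
  fixes n :: nat
  obtains k where "n = 3 * k" | k where "n = Suc (3 * k)" | k where "n = Suc (Suc (3 * k))"
proof -
  have "n = 3 * (n div 3) \<or> n = Suc (3 * (n div 3)) \<or> n = Suc (Suc (3 * (n div 3)))" by arith
  with that show thesis by blast
qed

lemma rot_cube [simp]: "rot (rot (rot n)) = n"
  by (cases n rule: mod_3_cases) auto

lemma rot_neq [simp]: "rot n \<noteq> n" "rot (rot n) \<noteq> n"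
  by (cases n rule: mod_3_cases; simp)+

lemma rot_eq_iff [simp]: "rot m = rot n \<longleftrightarrow> m = n"
  by (metis rot_cube)

fun letter_map :: "(nat \<rightharpoonup> nat) \<Rightarrow> bool \<Rightarrow> nat \<rightharpoonup> nat" where
  "letter_map \<sigma> True x = \<sigma> x"
| "letter_map \<sigma> False x = Some (rot x)"

fun run :: "(nat \<rightharpoonup> nat) \<Rightarrow> bool list \<Rightarrow> nat \<rightharpoonup> nat" where
  "run \<sigma> [] x = Some x"
| "run \<sigma> (c # w) x = Option.bind (run \<sigma> w x) (letter_map \<sigma> c)"

text \<open>Fixed points of \<open>\<sigma>\<close> are allowed, as the involution need not act freely. The relation in the last clause
  is the graph of the partial injection \<open>us\<close>.\<close>

definition admissible :: "(nat \<rightharpoonup> nat) \<Rightarrow> bool" where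
  "admissible \<sigma> \<longleftrightarrow> finite (dom \<sigma>) \<and> (\<forall>x y. \<sigma> x = Some y \<longrightarrow> \<sigma> y = Some x)
    \<and> acyclic {(x, rot y) |x y. \<sigma> x = Some y}"

lemma admissible_sym: "admissible \<sigma> \<Longrightarrow> \<sigma> x = Some y \<Longrightarrow> \<sigma> y = Some x"
  and admissible_finite: "admissible \<sigma> \<Longrightarrow> finite (dom \<sigma>)"
  and admissible_acyclic: "admissible \<sigma> \<Longrightarrow> acyclic {(x, rot y) |x y. \<sigma> x = Some y}"
  unfolding admissible_def by blast+

lemma run_append: "run \<sigma> (v @ w) x = Option.bind (run \<sigma> w x) (run \<sigma> v)"
  by (cases "run \<sigma> w x"; induction v) auto

lemma run_mono:
  assumes "\<sigma> \<subseteq>\<^sub>m \<tau>" "run \<sigma> w x = Some y"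
  shows "run \<tau> w x = Some y"
  using assms(2)
proof (induction w arbitrary: y)
  case (Cons c w)
  then obtain z where z: "run \<sigma> w x = Some z" "letter_map \<sigma> c z = Some y"
    by (auto simp: bind_eq_Some_conv)
  then have "letter_map \<tau> c z = Some y"
    using assms(1) by (cases c) (auto simp: map_le_def dom_def)
  with z Cons.IH show ?case by simp
qed simp

definition inv_word :: "bool list \<Rightarrow> bool list" where
  "inv_word w = concat (map (\<lambda>c. if c then [True] else [False, False]) (rev w))"

lemma run_inv_word:
  assumes "admissible \<sigma>" "run \<sigma> w x = Some y"
  shows "run \<sigma> (inv_word w) y = Some x"
  using assms(2)
proof (induction w arbitrary: y)
  case (Cons c w)
  then obtain z where z: "run \<sigma> w x = Some z" "letter_map \<sigma> c z = Some y"
    by (auto simp: bind_eq_Some_conv)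
  then have "run \<sigma> (if c then [True] else [False, False]) y = Some z"
    using admissible_sym[OF assms(1), of z y] by (cases c) auto
  with Cons.IH[OF z(1)] show ?case by (simp add: inv_word_def run_append)
qed (simp add: inv_word_def)

text \<open>A cycle can only use arcs that can be both entered and left.\<close>

lemma acyclic_dead_arcs:
  assumes "acyclic r"
    and new: "\<And>x y. (x, y) \<in> r' - r \<Longrightarrow> x \<notin> Range r' \<or> y \<notin> Domain r'"
  shows "acyclic r'"
proof -
  have *: "(x, y) \<in> r\<^sup>+" if "(x, y) \<in> r'\<^sup>+" "x \<in> Range r'" "y \<in> Domain r'" for x y
    using that
  proof (induction rule: trancl_induct)
    case (base y)
    then have "(x, y) \<in> r" using new[of x y] by blast
    then show ?case by (rule r_into_trancl)
  next
    case (step y z)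
    have "y \<in> Range (r'\<^sup>+)" using step.hyps(1) by (rule RangeI)
    then have "y \<in> Range r'" by (simp only: trancl_range)
    with step.hyps(2) step.prems(2) have "(y, z) \<in> r" using new[of y z] by blast
    moreover have "(x, y) \<in> r\<^sup>+" using step.IH[OF step.prems(1)] step.hyps(2) by blast
    ultimately show ?case by (rule trancl_into_trancl[rotated])
  qed
  show ?thesis
  proof (rule acyclicI, intro allI notI)
    fix x assume x: "(x, x) \<in> r'\<^sup>+"
    then have "x \<in> Range (r'\<^sup>+)" "x \<in> Domain (r'\<^sup>+)" by blast+
    then have "x \<in> Range r'" "x \<in> Domain r'" by (simp_all only: trancl_range trancl_domain)
    with *[OF x] assms(1) show False by (simp add: acyclic_def)
  qed
qed

text \<open>The condition on a new pair \<open>x \<mapsto> y\<close> says that the arc from \<open>x\<close> to \<open>rot y\<close> cannot lie on a cycle of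
  \<open>us\<close>. Either the involution is undefined at \<open>rot y\<close>, so that the arc leads to a dead end, or it is
  undefined at \<open>rot (rot x)\<close>, the only point whose partner could be mapped to \<open>x\<close> by \<open>rot\<close>.\<close>

lemma admissible_map_add:
  assumes \<sigma>: "admissible \<sigma>" and "finite (dom \<tau>)" and disj: "dom \<sigma> \<inter> dom \<tau> = {}"
    and sym: "\<And>x y. \<tau> x = Some y \<Longrightarrow> \<tau> y = Some x"
    and dead: "\<And>x y. \<tau> x = Some y \<Longrightarrow>
      rot y \<notin> dom (\<sigma> ++ \<tau>) \<or> rot (rot x) \<notin> dom (\<sigma> ++ \<tau>)"
  shows "admissible (\<sigma> ++ \<tau>)" "\<sigma> \<subseteq>\<^sub>m \<sigma> ++ \<tau>"
proof -
  let ?r = "{(x, rot y) |x y. \<sigma> x = Some y}" and ?r' = "{(x, rot y) |x y. (\<sigma> ++ \<tau>) x = Some y}"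
  show le: "\<sigma> \<subseteq>\<^sub>m \<sigma> ++ \<tau>"
    using disj by (metis map_add_comm map_le_map_add)
  have symm: "(\<sigma> ++ \<tau>) y = Some x" if xy: "(\<sigma> ++ \<tau>) x = Some y" for x y
  proof (cases "\<tau> x")
    case None
    with xy have "\<sigma> x = Some y" by (simp add: map_add_Some_iff)
    then have "\<sigma> y = Some x" by (rule admissible_sym[OF \<sigma>])
    with le show ?thesis by (metis domI map_le_def)
  next
    case (Some z)
    with xy have "\<tau> x = Some y" by (simp add: map_add_Some_iff)
    from sym[OF this] show ?thesis by (simp add: map_add_Some_iff)
  qed
  have "acyclic ?r'"
  proof (rule acyclic_dead_arcs)
    show "acyclic ?r" using \<sigma> by (rule admissible_acyclic)
    fix x z assume "(x, z) \<in> ?r' - ?r"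
    then obtain y where y: "z = rot y" "\<tau> x = Some y"
      by (auto simp: map_add_Some_iff)
    show "x \<notin> Range ?r' \<or> z \<notin> Domain ?r'"
      using dead[OF y(2)]
    proof
      assume *: "rot (rot x) \<notin> dom (\<sigma> ++ \<tau>)"
      have "x \<notin> Range ?r'"
      proof
        assume "x \<in> Range ?r'"
        then obtain v w where vw: "(\<sigma> ++ \<tau>) v = Some w" "x = rot w"
          unfolding Range_iff mem_Collect_eq prod.inject by (elim exE conjE) (rule that)
        with symm[OF vw(1)] * show False by auto
      qed
      then show ?thesis ..
    qed (use y in auto)
  qed
  moreover have "finite (dom (\<sigma> ++ \<tau>))" using admissible_finite[OF \<sigma>] assms(2) by simp
  ultimately show "admissible (\<sigma> ++ \<tau>)" unfolding admissible_def using symm by blast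
qed

lemma fresh_orbits:
  assumes "finite K"
  obtains c :: "nat \<Rightarrow> nat" where "inj c"
    "\<And>e. c e \<notin> K" "\<And>e. rot (c e) \<notin> K" "\<And>e. rot (rot (c e)) \<notin> K"
    "\<And>e e'. c e \<noteq> rot (c e')" "\<And>e e'. c e \<noteq> rot (rot (c e'))"
proof -
  obtain N where N: "\<forall>x\<in>K. x < N"
    using assms unfolding finite_nat_set_iff_bounded by (elim exE) (rule that)
  have K: "x \<notin> K" if "N \<le> x" for x using that N by auto
  define c where "c e = 3 * (N + e)" for e
  have rot1: "rot (c e) = Suc (c e)" for e
    unfolding c_def using rot_mult(1)[of "N + e"] by simp
  have rot2: "rot (rot (c e)) = Suc (Suc (c e))" for e
    unfolding rot1 unfolding c_def using rot_mult(2)[of "N + e"] by simp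
  show thesis
  proof (rule that)
    show "inj c" by (rule injI) (simp add: c_def)
    show "c e \<notin> K" "rot (c e) \<notin> K" "rot (rot (c e)) \<notin> K" for e
      unfolding rot2 unfolding rot1 by (rule K; simp add: c_def)+
    show "c e \<noteq> rot (c e')" "c e \<noteq> rot (rot (c e'))" for e e'
      unfolding rot2 unfolding rot1 unfolding c_def by presburger+
  qed
qed

text \<open>The basic move. Since only one point of each new 3-cycle is used, the partial injection \<open>us\<close> has a dead
  end right behind the new partner \<open>c e\<close> of \<open>e\<close> and nothing in front of \<open>c e\<close>, so no cycle is closed. The
  set \<open>F\<close> collects points to be kept out of the new 3-cycles.\<close>

lemma extend_to_fresh_orbits:
  assumes "admissible \<sigma>" "finite E" "E \<inter> dom \<sigma> = {}" "finite F"
  obtains \<sigma>' c where "admissible \<sigma>'" "\<sigma> \<subseteq>\<^sub>m \<sigma>'" "\<And>e. e \<in> E \<Longrightarrow> \<sigma>' e = Some (c e)"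
    "dom \<sigma>' = dom \<sigma> \<union> E \<union> c ` E" "inj c" "\<And>e. c e \<notin> dom \<sigma> \<union> E \<union> F"
    "\<And>e. rot (c e) \<notin> dom \<sigma>' \<union> F" "\<And>e. rot (rot (c e)) \<notin> dom \<sigma>' \<union> F"
    "\<And>e e'. c e \<noteq> rot (c e')"
proof -
  have "finite (dom \<sigma> \<union> E \<union> F)" using assms admissible_finite by simp
  then obtain c :: "nat \<Rightarrow> nat" where c: "inj c" "\<And>e. c e \<notin> dom \<sigma> \<union> E \<union> F"
    "\<And>e. rot (c e) \<notin> dom \<sigma> \<union> E \<union> F" "\<And>e. rot (rot (c e)) \<notin> dom \<sigma> \<union> E \<union> F"
    "\<And>e e'. c e \<noteq> rot (c e')" "\<And>e e'. c e \<noteq> rot (rot (c e'))"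
    using fresh_orbits by metis
  define \<tau> where "\<tau> = (\<lambda>x. if x \<in> E then Some (c x)
    else if x \<in> c ` E then Some (inv_into UNIV c x) else None)"
  have \<tau>E: "\<tau> e = Some (c e)" "\<tau> (c e) = Some e" if "e \<in> E" for e
    using that c(2) by (simp_all add: \<tau>_def inv_f_f[OF c(1)])
  have dom\<tau>: "dom \<tau> = E \<union> c ` E" by (auto simp: \<tau>_def dom_def)
  have dom: "dom (\<sigma> ++ \<tau>) = dom \<sigma> \<union> E \<union> c ` E" by (auto simp: dom\<tau> simp del: domIff)
  have rot: "rot (c e) \<notin> dom (\<sigma> ++ \<tau>) \<union> F" "rot (rot (c e)) \<notin> dom (\<sigma> ++ \<tau>) \<union> F" for e
    unfolding dom using c(3-6) by (metis Un_iff imageE)+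
  have dis: "dom \<sigma> \<inter> dom \<tau> = {}"
    using assms(3) c(2) unfolding dom\<tau> by blast
  have fin: "finite (dom \<tau>)" using assms(2) by (simp add: dom\<tau>)
  have pair: "\<exists>e\<in>E. (x = e \<and> y = c e) \<or> (x = c e \<and> y = e)" if xy: "\<tau> x = Some y" for x y
  proof -
    have "x \<in> E \<union> c ` E" unfolding dom\<tau>[symmetric] using xy by (rule domI)
    then show ?thesis
    proof (elim UnE imageE)
      assume "x \<in> E" then show ?thesis using xy \<tau>E(1)[of x] by auto
    next
      fix e assume "x = c e" "e \<in> E" then show ?thesis using xy \<tau>E(2)[of e] by auto
    qed
  qed
  have sym: "\<tau> y = Some x" if "\<tau> x = Some y" for x y
    using pair[OF that] \<tau>E by blast
  have dead: "rot y \<notin> dom (\<sigma> ++ \<tau>) \<or> rot (rot x) \<notin> dom (\<sigma> ++ \<tau>)"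
    if xy: "\<tau> x = Some y" for x y
  proof -
    obtain e where "x = e \<and> y = c e \<or> x = c e \<and> y = e" using pair[OF xy] by blast
    then show ?thesis using rot[of e] by (elim disjE conjE) simp_all
  qed
  show thesis
  proof (rule that)
    show "admissible (\<sigma> ++ \<tau>)" "\<sigma> \<subseteq>\<^sub>m \<sigma> ++ \<tau>"
      using admissible_map_add[OF assms(1) fin dis sym dead] by blast+
    show "(\<sigma> ++ \<tau>) e = Some (c e)" if "e \<in> E" for e
      using \<tau>E(1)[OF that] by simp
    show "dom (\<sigma> ++ \<tau>) = dom \<sigma> \<union> E \<union> c ` E" by (rule dom)
  qed (fact c rot)+
qed

section \<open>Extending a finite partial involution\<close>

text \<open>The powers of \<open>us\<close>. The name refers to the image of \<open>us\<close> in the modular group, a parabolic element.\<close>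

abbreviation parabolic :: "nat \<Rightarrow> bool list" where
  "parabolic n \<equiv> concat (replicate n [False, True])"

lemma parabolic_add: "parabolic (m + n) = parabolic m @ parabolic n"
  by (simp add: replicate_add)

text \<open>Starting from undefined points, \<open>us\<close> is repeatedly continued through fresh 3-cycles. Each time, \<open>us\<close>
  leaves the new 3-cycle through one of its two free points. The other one, which is where \<open>u\<^sup>2s\<close> leads,
  is protected by adding it to \<open>F\<close>. It thus stays undefined no matter how far the chain is continued.\<close>

lemma extend_along_parabolic:
  assumes "admissible \<sigma>" "finite A" "finite F" "A \<inter> dom \<sigma> = {}" "F \<inter> dom \<sigma> = {}" "A \<inter> F = {}"
  shows "\<exists>\<sigma>'. admissible \<sigma>' \<and> \<sigma> \<subseteq>\<^sub>m \<sigma>' \<and> F \<inter> dom \<sigma>' = {} \<and>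
    (\<forall>e\<in>A. \<forall>j<n. \<exists>q. run \<sigma>' ([False, False, True] @ parabolic j) e = Some q \<and> q \<notin> dom \<sigma>')"
  using assms
proof (induction n arbitrary: \<sigma> A F)
  case 0
  then show ?case by (intro exI[of _ \<sigma>]) auto
next
  case (Suc n)
  obtain \<sigma>1 c where s: "admissible \<sigma>1" "\<sigma> \<subseteq>\<^sub>m \<sigma>1" "\<And>e. e \<in> A \<Longrightarrow> \<sigma>1 e = Some (c e)"
    "dom \<sigma>1 = dom \<sigma> \<union> A \<union> c ` A" "inj c" "\<And>e. c e \<notin> dom \<sigma> \<union> A \<union> F"
    "\<And>e. rot (c e) \<notin> dom \<sigma>1 \<union> F" "\<And>e. rot (rot (c e)) \<notin> dom \<sigma>1 \<union> F"
    "\<And>e e'. c e \<noteq> rot (c e')"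
    using extend_to_fresh_orbits[OF Suc.prems(1,2,4,3)] by metis
  define A1 where "A1 = (\<lambda>e. rot (c e)) ` A"
  define F1 where "F1 = F \<union> (\<lambda>e. rot (rot (c e))) ` A"
  have "F \<inter> dom \<sigma>1 = {}" unfolding s(4) using Suc.prems(5,6) s(6) by blast
  then have *: "A1 \<inter> dom \<sigma>1 = {}" "F1 \<inter> dom \<sigma>1 = {}"
    unfolding A1_def F1_def using s(7,8) by blast+
  have **: "A1 \<inter> F1 = {}"
    using s(7,9) by (auto simp: A1_def F1_def)
  have "finite A1" "finite F1" using Suc.prems by (simp_all add: A1_def F1_def)
  then obtain \<sigma>' where \<sigma>': "admissible \<sigma>'" "\<sigma>1 \<subseteq>\<^sub>m \<sigma>'" "F1 \<inter> dom \<sigma>' = {}"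
    and r: "\<And>e j. e \<in> A1 \<Longrightarrow> j < n \<Longrightarrow>
      \<exists>q. run \<sigma>' ([False, False, True] @ parabolic j) e = Some q \<and> q \<notin> dom \<sigma>'"
    using Suc.IH[OF s(1) _ _ * **] by metis
  have "\<exists>q. run \<sigma>' ([False, False, True] @ parabolic j) e = Some q \<and> q \<notin> dom \<sigma>'"
    if e: "e \<in> A" and j: "j < Suc n" for e j
  proof (cases j)
    case 0
    have "run \<sigma>1 ([False, False, True] @ parabolic j) e = Some (rot (rot (c e)))"
      using s(3)[OF e] by (simp add: 0)
    moreover have "rot (rot (c e)) \<notin> dom \<sigma>'"
      using \<sigma>'(3) e unfolding F1_def by blast
    ultimately show ?thesis using run_mono[OF \<sigma>'(2)] by blast
  next
    case (Suc i)
    have "run \<sigma>1 [False, True] e = Some (rot (c e))"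
      using s(3)[OF e] by (simp)
    then have "run \<sigma>' [False, True] e = Some (rot (c e))"
      by (rule run_mono[OF \<sigma>'(2)])
    moreover have "[False, False, True] @ parabolic j =
        ([False, False, True] @ parabolic i) @ [False, True]"
      using parabolic_add[of i 1] Suc by simp
    ultimately have "run \<sigma>' ([False, False, True] @ parabolic j) e
        = run \<sigma>' ([False, False, True] @ parabolic i) (rot (c e))"
      by (metis run_append bind.bind_lunit)
    moreover have "rot (c e) \<in> A1" using e by (simp add: A1_def)
    ultimately show ?thesis
      using r[of "rot (c e)" i] j Suc by simp
  qed
  moreover have "\<sigma> \<subseteq>\<^sub>m \<sigma>'" using s(2) \<sigma>'(2) map_le_trans by blast
  moreover have "F \<inter> dom \<sigma>' = {}" using \<sigma>'(3) by (auto simp: F1_def)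
  ultimately show ?case using \<sigma>'(1) by blast
qed

text \<open>Following \<open>us\<close> must leave a finite domain, because there are no cycles.\<close>

lemma exit_along_parabolic:
  assumes "admissible \<sigma>"
  shows "\<exists>d e. run \<sigma> (parabolic d) p = Some e \<and> e \<notin> dom \<sigma> \<and> (e = p \<or> e \<in> rot ` dom \<sigma>)"
proof -
  let ?r = "{(x, rot y) |x y. \<sigma> x = Some y}"
  have "?r \<subseteq> dom \<sigma> \<times> rot ` dom \<sigma>" using admissible_sym[OF assms] by blast
  moreover have "finite (dom \<sigma> \<times> rot ` dom \<sigma>)" using admissible_finite[OF assms] by simp
  ultimately have "finite ?r" by (rule finite_subset)
  then have "wf (?r\<inverse>)" using admissible_acyclic[OF assms] by (rule finite_acyclic_wf_converse)
  then show ?thesis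
  proof (induction p rule: wf_induct_rule)
    case (less p)
    show ?case
    proof (cases "\<sigma> p")
      case None
      then show ?thesis by (intro exI[of _ 0] exI[of _ p]) (simp add: domIff)
    next
      case (Some y)
      then have y: "(rot y, p) \<in> ?r\<inverse>" "y \<in> dom \<sigma>" using admissible_sym[OF assms] by blast+
      from less[OF y(1)] obtain d e where de: "run \<sigma> (parabolic d) (rot y) = Some e" "e \<notin> dom \<sigma>"
        "e = rot y \<or> e \<in> rot ` dom \<sigma>" by blast
      moreover have "parabolic (Suc d) = parabolic d @ [False, True]"
        using parabolic_add[of d 1] by simp
      ultimately have "run \<sigma> (parabolic (Suc d)) p = Some e"
        using Some by (simp add: run_append)
      with de y(2) show ?thesis by blast
    qed
  qed
qed

text \<open>All exits of chains within the domain of \<open>\<sigma>\<close> are continued for more steps than any point of \<open>P\<close> needs to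
  reach its exit. After the same number of steps every point of \<open>P\<close> is then on a new part of a chain,
  at a place depending on when it reached its exit, and one application of \<open>u\<^sup>2s\<close> takes it aside.\<close>

lemma extend_to_escape:
  assumes "admissible \<sigma>" "finite P"
  shows "\<exists>\<sigma>' w. admissible \<sigma>' \<and> \<sigma> \<subseteq>\<^sub>m \<sigma>' \<and> (\<forall>p\<in>P. \<exists>q. run \<sigma>' w p = Some q \<and> q \<notin> dom \<sigma>')"
proof -
  define A where "A = (P \<union> rot ` dom \<sigma>) - dom \<sigma>"
  have finA: "finite A" using assms admissible_finite by (simp add: A_def)
  have "\<forall>p. \<exists>d e. run \<sigma> (parabolic d) p = Some e \<and> e \<notin> dom \<sigma> \<and> (e = p \<or> e \<in> rot ` dom \<sigma>)"
    using exit_along_parabolic[OF assms(1)] by blast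
  then obtain d where d: "\<And>p. \<exists>e. run \<sigma> (parabolic (d p)) p = Some e \<and> e \<notin> dom \<sigma>
      \<and> (e = p \<or> e \<in> rot ` dom \<sigma>)" by metis
  have "finite (d ` P)" using assms(2) by simp
  then obtain M where M: "\<And>p. p \<in> P \<Longrightarrow> d p \<le> M"
    unfolding finite_nat_set_iff_bounded_le by blast
  obtain \<sigma>' where \<sigma>': "admissible \<sigma>'" "\<sigma> \<subseteq>\<^sub>m \<sigma>'" and
    r: "\<And>e j. e \<in> A \<Longrightarrow> j < Suc M \<Longrightarrow>
      \<exists>q. run \<sigma>' ([False, False, True] @ parabolic j) e = Some q \<and> q \<notin> dom \<sigma>'"
    using extend_along_parabolic[OF assms(1) finA finite.emptyI, of "Suc M"] unfolding A_def by blast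
  have "\<exists>q. run \<sigma>' ([False, False, True] @ parabolic M) p = Some q \<and> q \<notin> dom \<sigma>'" if pP: "p \<in> P" for p
  proof -
    obtain e where e: "run \<sigma> (parabolic (d p)) p = Some e" "e \<in> A"
      using d[of p] pP unfolding A_def by blast
    have "parabolic M = parabolic (M - d p) @ parabolic (d p)"
      using parabolic_add[of "M - d p" "d p"] M[OF pP] by simp
    then show ?thesis
      using r[OF e(2), of "M - d p"] run_mono[OF \<sigma>'(2) e(1)] by (simp add: run_append)
  qed
  with \<sigma>' show ?thesis by blast
qed

text \<open>Pairing two given undefined points could close a cycle of \<open>us\<close>. It does not if \<open>rot\<close> takes each of them
  to a point that remains undefined, since both new arcs are then dead ends.\<close>

lemma extend_by_pairing:
  assumes "admissible \<sigma>" "finite I" "inj_on p I" "inj_on q I" "p ` I \<inter> q ` I = {}"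
    and out: "\<And>i. i \<in> I \<Longrightarrow> p i \<notin> dom \<sigma>" "\<And>i. i \<in> I \<Longrightarrow> q i \<notin> dom \<sigma>"
    and dead: "\<And>i. i \<in> I \<Longrightarrow> rot (p i) \<notin> dom \<sigma> \<union> p ` I \<union> q ` I"
      "\<And>i. i \<in> I \<Longrightarrow> rot (q i) \<notin> dom \<sigma> \<union> p ` I \<union> q ` I"
  obtains \<sigma>' where "admissible \<sigma>'" "\<sigma> \<subseteq>\<^sub>m \<sigma>'" "\<And>i. i \<in> I \<Longrightarrow> \<sigma>' (p i) = Some (q i)"
proof -
  define \<tau> where "\<tau> x = (if x \<in> p ` I then Some (q (inv_into I p x))
    else if x \<in> q ` I then Some (p (inv_into I q x)) else None)" for x
  have \<tau>: "\<tau> (p i) = Some (q i)" "\<tau> (q i) = Some (p i)" if "i \<in> I" for i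
  proof -
    have "q i \<notin> p ` I" using that assms(5) by blast
    with that show "\<tau> (p i) = Some (q i)" "\<tau> (q i) = Some (p i)"
      by (simp_all add: \<tau>_def inv_into_f_f[OF assms(3)] inv_into_f_f[OF assms(4)])
  qed
  have dom\<tau>: "dom \<tau> = p ` I \<union> q ` I" by (auto simp: \<tau>_def dom_def)
  have dom: "dom (\<sigma> ++ \<tau>) = dom \<sigma> \<union> p ` I \<union> q ` I" by (auto simp: dom\<tau> simp del: domIff)
  have pair: "\<exists>i\<in>I. (x = p i \<and> y = q i) \<or> (x = q i \<and> y = p i)" if xy: "\<tau> x = Some y" for x y
  proof -
    have "x \<in> p ` I \<union> q ` I" unfolding dom\<tau>[symmetric] using xy by (rule domI)
    then show ?thesis
    proof (elim UnE imageE)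
      fix i assume "x = p i" "i \<in> I" then show ?thesis using xy \<tau>(1)[of i] by auto
    next
      fix i assume "x = q i" "i \<in> I" then show ?thesis using xy \<tau>(2)[of i] by auto
    qed
  qed
  have sym: "\<tau> y = Some x" if "\<tau> x = Some y" for x y
    using pair[OF that] \<tau> by blast
  have dead': "rot y \<notin> dom (\<sigma> ++ \<tau>) \<or> rot (rot x) \<notin> dom (\<sigma> ++ \<tau>)"
    if xy: "\<tau> x = Some y" for x y
  proof -
    obtain i where "i \<in> I" "x = p i \<and> y = q i \<or> x = q i \<and> y = p i" using pair[OF xy] by blast
    then show ?thesis using dead[of i] unfolding dom by (elim disjE conjE) simp_all
  qed
  have fin: "finite (dom \<tau>)" and dis: "dom \<sigma> \<inter> dom \<tau> = {}"
    unfolding dom\<tau> using assms(2) out by blast+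
  show thesis
  proof (rule that)
    show "admissible (\<sigma> ++ \<tau>)" "\<sigma> \<subseteq>\<^sub>m \<sigma> ++ \<tau>"
      using admissible_map_add[OF assms(1) fin dis sym dead'] by blast+
    show "(\<sigma> ++ \<tau>) (p i) = Some (q i)" if "i \<in> I" for i
      using \<tau>(1)[OF that] by simp
  qed
qed

lemma run_inj:
  assumes "admissible \<sigma>" "run \<sigma> w x = Some z" "run \<sigma> w y = Some z"
  shows "x = y"
  using run_inv_word[OF assms(1,2)] run_inv_word[OF assms(1,3)] by simp

text \<open>Once all points have escaped, every position is joined by \<open>s\<close> to a fresh 3-cycle, and the two other
  points of that 3-cycle are joined to further fresh 3-cycles. One of these two branches is used for the
  points as entries of \<open>xs\<close>, the other one for the points as entries of \<open>ys\<close>. A point may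
  occur in both tuples, and the branches keep its two roles apart. Pairing corresponding branches yields
  words that take \<open>xs ! i\<close> and \<open>ys ! i\<close> to the same point \<open>q i\<close>.\<close>

lemma extend_to_connect_tuples:
  assumes "admissible \<sigma>" "distinct xs" "distinct ys" "length xs = length ys"
  shows "\<exists>\<sigma>' w. admissible \<sigma>' \<and> \<sigma> \<subseteq>\<^sub>m \<sigma>' \<and> (\<forall>i<length xs. run \<sigma>' w (xs ! i) = Some (ys ! i))"
proof -
  define P where "P = set xs \<union> set ys"
  define I where "I = {..<length xs}"
  have P: "xs ! i \<in> P" "ys ! i \<in> P" if "i \<in> I" for i
    using that assms(4) by (auto simp: P_def I_def)
  have "finite P" by (simp add: P_def)
  then obtain \<sigma>1 w where 1: "admissible \<sigma>1" "\<sigma> \<subseteq>\<^sub>m \<sigma>1"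
    and "\<forall>p\<in>P. \<exists>q. run \<sigma>1 w p = Some q \<and> q \<notin> dom \<sigma>1"
    using extend_to_escape[OF assms(1)] by metis
  then obtain z where z: "\<And>p. p \<in> P \<Longrightarrow> run \<sigma>1 w p = Some (z p)" "\<And>p. p \<in> P \<Longrightarrow> z p \<notin> dom \<sigma>1"
    by metis
  have z_inj: "p = q" if "p \<in> P" "q \<in> P" "z p = z q" for p q
    using run_inj[OF 1(1), of w p "z p" q] z(1)[OF that(1)] z(1)[OF that(2)] that(3) by simp
  have "finite (z ` P)" "z ` P \<inter> dom \<sigma>1 = {}" using \<open>finite P\<close> z(2) by blast+
  then obtain \<sigma>2 c where 2: "admissible \<sigma>2" "\<sigma>1 \<subseteq>\<^sub>m \<sigma>2" "\<And>e. e \<in> z ` P \<Longrightarrow> \<sigma>2 e = Some (c e)" "inj c"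
    "\<And>e. rot (c e) \<notin> dom \<sigma>2 \<union> {}" "\<And>e. rot (rot (c e)) \<notin> dom \<sigma>2 \<union> {}"
    "\<And>e e'. c e \<noteq> rot (c e')"
    using extend_to_fresh_orbits[OF 1(1) _ _ finite.emptyI] by metis
  define E where "E = (\<lambda>e. rot (c e)) ` z ` P \<union> (\<lambda>e. rot (rot (c e))) ` z ` P"
  have "finite E" "E \<inter> dom \<sigma>2 = {}" using \<open>finite P\<close> 2(5,6) by (auto simp: E_def simp del: domIff)
  then obtain \<sigma>3 d where 3: "admissible \<sigma>3" "\<sigma>2 \<subseteq>\<^sub>m \<sigma>3" "\<And>e. e \<in> E \<Longrightarrow> \<sigma>3 e = Some (d e)" "inj d"
    "\<And>e. rot (d e) \<notin> dom \<sigma>3 \<union> {}" "\<And>e. rot (rot (d e)) \<notin> dom \<sigma>3 \<union> {}"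
    "\<And>e e'. d e \<noteq> rot (d e')"
    using extend_to_fresh_orbits[OF 2(1) _ _ finite.emptyI] by metis
  \<comment> \<open>\<open>rot (rot (d _))\<close> is left undefined, which makes the pairing of \<open>p i\<close> with \<open>q i\<close> harmless.\<close>
  define p where "p i = rot (d (rot (c (z (xs ! i)))))" for i
  define q where "q i = rot (d (rot (rot (c (z (ys ! i))))))" for i
  have p_inj: "inj_on p I" and q_inj: "inj_on q I"
  proof -
    show "inj_on p I"
    proof (rule inj_onI)
      fix i j assume ij: "i \<in> I" "j \<in> I" and "p i = p j"
      then have "z (xs ! i) = z (xs ! j)" by (simp add: p_def inj_eq[OF 2(4)] inj_eq[OF 3(4)])
      from z_inj[OF P(1)[OF ij(1)] P(1)[OF ij(2)] this] ij assms(2) show "i = j"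
        by (simp add: I_def nth_eq_iff_index_eq)
    qed
    show "inj_on q I"
    proof (rule inj_onI)
      fix i j assume ij: "i \<in> I" "j \<in> I" and "q i = q j"
      then have "z (ys ! i) = z (ys ! j)" by (simp add: q_def inj_eq[OF 2(4)] inj_eq[OF 3(4)])
      from z_inj[OF P(2)[OF ij(1)] P(2)[OF ij(2)] this] ij assms(3,4) show "i = j"
        by (simp add: I_def nth_eq_iff_index_eq)
    qed
  qed
  have pq: "p i \<noteq> q j" for i j
    using 2(7) by (simp add: p_def q_def inj_eq[OF 3(4)])
  have rot_pq: "rot (p i) \<noteq> p j" "rot (p i) \<noteq> q j" "rot (q i) \<noteq> p j" "rot (q i) \<noteq> q j" for i j
    using 3(7)[symmetric] by (simp_all add: p_def q_def)
  have dead: "rot (p i) \<notin> dom \<sigma>3 \<union> p ` I \<union> q ` I" "rot (q i) \<notin> dom \<sigma>3 \<union> p ` I \<union> q ` I" for i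
    using 3(6) rot_pq unfolding p_def q_def by blast+
  have out: "p i \<notin> dom \<sigma>3" "q i \<notin> dom \<sigma>3" for i
    using 3(5) unfolding p_def q_def by blast+
  have "finite I" "p ` I \<inter> q ` I = {}" using pq by (auto simp: I_def)
  then obtain \<sigma>4 where 4: "admissible \<sigma>4" "\<sigma>3 \<subseteq>\<^sub>m \<sigma>4" "\<And>i. i \<in> I \<Longrightarrow> \<sigma>4 (p i) = Some (q i)"
    using extend_by_pairing[OF 3(1) _ p_inj q_inj _ out dead] by metis
  have s34: "\<sigma>4 e = Some (d e)" if "e \<in> E" for e
    using 4(2) 3(3)[OF that] unfolding map_le_def by (metis domI)
  have "\<sigma>2 \<subseteq>\<^sub>m \<sigma>4" using 3(2) 4(2) by (rule map_le_trans)
  then have s24: "\<sigma>4 e = Some (c e)" if "e \<in> z ` P" for e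
    using 2(3)[OF that] unfolding map_le_def by (metis domI)
  have s14: "\<sigma>1 \<subseteq>\<^sub>m \<sigma>4" using 2(2) \<open>\<sigma>2 \<subseteq>\<^sub>m \<sigma>4\<close> by (rule map_le_trans)
  have r: "run \<sigma>4 w x = Some (z x)" if "x \<in> P" for x
    using run_mono[OF s14 z(1)[OF that]] .
  have to_q: "run \<sigma>4 ([True, False, True, False, True] @ w) (xs ! i) = Some (q i)"
    "run \<sigma>4 ([False, True, False, False, True] @ w) (ys ! i) = Some (q i)" if i: "i \<in> I" for i
  proof -
    have "rot (c (z (xs ! i))) \<in> E" "rot (rot (c (z (ys ! i)))) \<in> E"
      using P[OF i] by (auto simp: E_def)
    note s34[OF this(1)] s34[OF this(2)]
    moreover have "\<sigma>4 (z (xs ! i)) = Some (c (z (xs ! i)))" "\<sigma>4 (z (ys ! i)) = Some (c (z (ys ! i)))"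
      using P[OF i] s24 by blast+
    ultimately show "run \<sigma>4 ([True, False, True, False, True] @ w) (xs ! i) = Some (q i)"
      "run \<sigma>4 ([False, True, False, False, True] @ w) (ys ! i) = Some (q i)"
      using r[OF P(1)[OF i]] r[OF P(2)[OF i]] 4(3)[OF i] by (simp_all add: p_def q_def)
  qed
  have "run \<sigma>4 (inv_word ([False, True, False, False, True] @ w) @ [True, False, True, False, True] @ w) (xs ! i)
      = Some (ys ! i)" if "i \<in> I" for i
    using run_inv_word[OF 4(1) to_q(2)[OF that]] to_q(1)[OF that]
    by (subst run_append) (simp del: append.simps)
  moreover have "\<sigma> \<subseteq>\<^sub>m \<sigma>4" using 1(2) s14 by (rule map_le_trans)
  ultimately show ?thesis using 4(1) unfolding I_def by blast
qed

text \<open>Each factor first joins the current position, at which the involution is undefined, to a fresh 3-cycle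
  and then rotates to one of the two free points there. The position is thus again an undefined one.\<close>

lemma extend_along_pos_word:
  assumes "w \<in> pos_words" "admissible \<sigma>" "p \<notin> dom \<sigma>"
  shows "\<exists>\<sigma>' q. admissible \<sigma>' \<and> \<sigma> \<subseteq>\<^sub>m \<sigma>' \<and> run \<sigma>' w p = Some q \<and> q \<notin> dom \<sigma>'"
  using assms(1)
proof induction
  case Nil
  then show ?case using assms(2,3) by (intro exI[of _ \<sigma>] exI[of _ p]) simp
next
  case (parabolic w)
  then obtain \<sigma>1 q where 1: "admissible \<sigma>1" "\<sigma> \<subseteq>\<^sub>m \<sigma>1" "run \<sigma>1 w p = Some q" "q \<notin> dom \<sigma>1" by blast
  then have "finite {q}" "{q} \<inter> dom \<sigma>1 = {}" by simp_all
  obtain \<sigma>2 c where 2: "admissible \<sigma>2" "\<sigma>1 \<subseteq>\<^sub>m \<sigma>2" "\<And>e. e \<in> {q} \<Longrightarrow> \<sigma>2 e = Some (c e)"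
    "\<And>e. rot (c e) \<notin> dom \<sigma>2 \<union> {}"
    using extend_to_fresh_orbits[OF 1(1) _ _ finite.emptyI] \<open>finite {q}\<close> \<open>{q} \<inter> dom \<sigma>1 = {}\<close> by metis
  have "run \<sigma>2 (False # True # w) p = Some (rot (c q))"
    using run_mono[OF 2(2) 1(3)] 2(3) by simp
  with 1(2) 2 show ?case by (meson UnCI map_le_trans)
next
  case (antiparabolic w)
  then obtain \<sigma>1 q where 1: "admissible \<sigma>1" "\<sigma> \<subseteq>\<^sub>m \<sigma>1" "run \<sigma>1 w p = Some q" "q \<notin> dom \<sigma>1" by blast
  then have "finite {q}" "{q} \<inter> dom \<sigma>1 = {}" by simp_all
  obtain \<sigma>2 c where 2: "admissible \<sigma>2" "\<sigma>1 \<subseteq>\<^sub>m \<sigma>2" "\<And>e. e \<in> {q} \<Longrightarrow> \<sigma>2 e = Some (c e)"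
    "\<And>e. rot (rot (c e)) \<notin> dom \<sigma>2 \<union> {}"
    using extend_to_fresh_orbits[OF 1(1) _ _ finite.emptyI] \<open>finite {q}\<close> \<open>{q} \<inter> dom \<sigma>1 = {}\<close> by metis
  have "run \<sigma>2 (False # False # True # w) p = Some (rot (rot (c q)))"
    using run_mono[OF 2(2) 1(3)] 2(3) by simp
  with 1(2) 2 show ?case by (meson UnCI map_le_trans)
qed

lemma run_rotations:
  assumes "k < 3"
  shows "\<exists>y\<in>{x, rot x, rot (rot x)}. run \<sigma> (replicate k False) x = Some y"
    and "\<exists>y\<in>{x, rot x, rot (rot x)}. run \<sigma> (replicate k False) y = Some x"
proof -
  have "k = 0 \<or> k = 1 \<or> k = 2" using assms by linarith
  then show "\<exists>y\<in>{x, rot x, rot (rot x)}. run \<sigma> (replicate k False) x = Some y"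
    "\<exists>y\<in>{x, rot x, rot (rot x)}. run \<sigma> (replicate k False) y = Some x"
    by (auto simp: numeral_2_eq_2)
qed

text \<open>The normal word is made to pass through a point \<open>p\<close> outside the domain after its initial rotations. Its
  leftmost \<open>s\<close> is then still undefined when it is needed, so it can lead to a 3-cycle different from the
  one containing the starting point.\<close>

lemma extend_to_move_point:
  assumes "u \<in> normal_words" "u \<noteq> []" "admissible \<sigma>"
  shows "\<exists>\<sigma>'. admissible \<sigma>' \<and> \<sigma> \<subseteq>\<^sub>m \<sigma>' \<and> (\<exists>x y. run \<sigma>' u x = Some y \<and> y \<noteq> x)"
  using assms(1,2)
proof (cases rule: normal_word_cases)
  case 1
  then show ?thesis using assms(3) by (intro exI[of _ \<sigma>]) simp
next
  case 2
  then show ?thesis using assms(3) by (intro exI[of _ \<sigma>]) simp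
next
  case (3 k w i)
  obtain p where "p \<notin> dom \<sigma>" using admissible_finite[OF assms(3)] by (meson ex_new_if_finite infinite_UNIV_nat)
  then obtain \<sigma>1 q where 1: "admissible \<sigma>1" "\<sigma> \<subseteq>\<^sub>m \<sigma>1" "run \<sigma>1 w p = Some q" "q \<notin> dom \<sigma>1"
    using extend_along_pos_word[OF 3(2) assms(3)] by metis
  define K where "K = {p, rot p, rot (rot p)}"
  have "finite {q}" "{q} \<inter> dom \<sigma>1 = {}" "finite K" using 1(4) by (auto simp: K_def)
  then obtain \<sigma>2 c where 2: "admissible \<sigma>2" "\<sigma>1 \<subseteq>\<^sub>m \<sigma>2" "\<And>e. e \<in> {q} \<Longrightarrow> \<sigma>2 e = Some (c e)"
    "\<And>e. c e \<notin> dom \<sigma>1 \<union> {q} \<union> K" "\<And>e. rot (c e) \<notin> dom \<sigma>2 \<union> K" "\<And>e. rot (rot (c e)) \<notin> dom \<sigma>2 \<union> K"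
    using extend_to_fresh_orbits[OF 1(1)] by metis
  obtain x where x: "x \<in> K" "run \<sigma>2 (replicate i False) x = Some p"
    using run_rotations(2)[OF 3(3)] unfolding K_def by blast
  obtain y where y: "y \<in> {c q, rot (c q), rot (rot (c q))}" "run \<sigma>2 (replicate k False) (c q) = Some y"
    using run_rotations(1)[OF 3(1)] by blast
  have "y \<notin> K" using y(1) 2(4,5,6) by blast
  have "run \<sigma>2 u x = Some y"
    using x(2) y(2) run_mono[OF 2(2) 1(3)] 2(3) by (simp add: 3(4) run_append)
  moreover have "\<sigma> \<subseteq>\<^sub>m \<sigma>2" using 1(2) 2(2) by (rule map_le_trans)
  ultimately show ?thesis using 2(1) x(1) \<open>y \<notin> K\<close> by blast
qed

section \<open>A generic involution\<close>

text \<open>The index type is countable, so that the requirements can be enumerated by \<open>from_nat\<close>.\<close>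

fun requirement :: "nat + (nat list \<times> nat list) + bool list \<Rightarrow> (nat \<rightharpoonup> nat) \<Rightarrow> bool" where
  "requirement (Inl n) \<sigma> \<longleftrightarrow> n \<in> dom \<sigma>"
| "requirement (Inr (Inl (xs, ys))) \<sigma> \<longleftrightarrow> (distinct xs \<and> distinct ys \<and> length xs = length ys \<longrightarrow>
    (\<exists>w. \<forall>i<length xs. run \<sigma> w (xs ! i) = Some (ys ! i)))"
| "requirement (Inr (Inr u)) \<sigma> \<longleftrightarrow> (u \<in> normal_words \<and> u \<noteq> [] \<longrightarrow>
    (\<exists>x y. run \<sigma> u x = Some y \<and> y \<noteq> x))"

lemma requirement_dense:
  assumes "admissible \<sigma>"
  shows "\<exists>\<sigma>'. admissible \<sigma>' \<and> \<sigma> \<subseteq>\<^sub>m \<sigma>' \<and> requirement r \<sigma>'"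
proof (cases r)
  case (Inl n)
  show ?thesis
  proof (cases "n \<in> dom \<sigma>")
    case True
    then show ?thesis using assms Inl by (intro exI[of _ \<sigma>]) simp
  next
    case False
    then obtain \<sigma>' c where "admissible \<sigma>'" "\<sigma> \<subseteq>\<^sub>m \<sigma>'" "dom \<sigma>' = dom \<sigma> \<union> {n} \<union> c ` {n}"
      using extend_to_fresh_orbits[OF assms _ _ finite.emptyI, of "{n}"] by (metis Int_insert_left_if0 Int_empty_left finite.emptyI finite.insertI)
    then show ?thesis using Inl by (intro exI[of _ \<sigma>']) simp
  qed
next
  case (Inr r')
  show ?thesis
  proof (cases r')
    case (Inl xys)
    then obtain xs ys where r: "r = Inr (Inl (xs, ys))" using Inr by (cases xys) simp
    show ?thesis
    proof (cases "distinct xs \<and> distinct ys \<and> length xs = length ys")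
      case True
      then obtain \<sigma>' w where "admissible \<sigma>'" "\<sigma> \<subseteq>\<^sub>m \<sigma>'"
        "\<forall>i<length xs. run \<sigma>' w (xs ! i) = Some (ys ! i)"
        using extend_to_connect_tuples[OF assms, of xs ys] by metis
      then show ?thesis unfolding r requirement.simps by (intro exI[of _ \<sigma>'] conjI impI exI[of _ w])
    next
      case False
      then have "requirement r \<sigma>" unfolding r requirement.simps by blast
      then show ?thesis using assms by (intro exI[of _ \<sigma>]) simp
    qed
  next
    case (Inr u)
    then have r: "r = Inr (Inr u)" using \<open>r = Inr r'\<close> by simp
    show ?thesis
    proof (cases "u \<in> normal_words \<and> u \<noteq> []")
      case True
      then show ?thesis using extend_to_move_point[OF _ _ assms, of u] unfolding r requirement.simps by blast
    next
      case False
      then have "requirement r \<sigma>" unfolding r requirement.simps by blast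
      then show ?thesis using assms by (intro exI[of _ \<sigma>]) simp
    qed
  qed
qed

lemma requirement_mono:
  assumes "\<sigma> \<subseteq>\<^sub>m \<tau>" "requirement r \<sigma>"
  shows "requirement r \<tau>"
proof (cases "(r, \<sigma>)" rule: requirement.cases)
  case (1 n)
  then show ?thesis using assms map_le_implies_dom_le[OF assms(1)] by auto
next
  case (2 xs ys)
  then show ?thesis using assms run_mono[OF assms(1)] by simp blast
next
  case (3 u)
  then show ?thesis using assms run_mono[OF assms(1)] by simp blast
qed

text \<open>The requirements are met one after the other along an increasing sequence of admissible maps. Those of
  the first kind make the union of the sequence total.\<close>

lemma generic_involution:
  obtains s :: "nat \<Rightarrow> nat" where "\<And>x. s (s x) = x" "\<And>r. requirement r (Some \<circ> s)"
proof -
  have "admissible Map.empty" by (simp add: admissible_def acyclic_def)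
  have "\<exists>f. \<forall>n. admissible (f n) \<and> f n \<subseteq>\<^sub>m f (Suc n) \<and> requirement (from_nat n) (f (Suc n))"
    using dependent_nat_choice[of "\<lambda>n. admissible" "\<lambda>n \<sigma> \<sigma>'. \<sigma> \<subseteq>\<^sub>m \<sigma>' \<and> requirement (from_nat n) \<sigma>'"]
      \<open>admissible Map.empty\<close> requirement_dense by (metis (no_types, lifting))
  then obtain f where f: "\<And>n. admissible (f n)" "\<And>n. f n \<subseteq>\<^sub>m f (Suc n)" "\<And>n. requirement (from_nat n) (f (Suc n))"
    by blast
  have mono: "f m \<subseteq>\<^sub>m f n" if "m \<le> n" for m n
    using that by (induction rule: dec_induct) (use f(2) map_le_trans in auto)
  have req: "\<exists>n. requirement r (f n)" for r
    using f(3)[of "to_nat r"] by auto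
  have "\<exists>n y. f n x = Some y" for x
    using req[of "Inl x"] by auto
  then obtain N s where s: "\<And>x. f (N x) x = Some (s x)" by metis
  have le: "f n \<subseteq>\<^sub>m Some \<circ> s" for n
    unfolding map_le_def
  proof
    fix x assume "x \<in> dom (f n)"
    then have "f n x = f (N x) x"
      using mono[of n "N x"] mono[of "N x" n] s[of x] unfolding map_le_def by (metis domI nle_le)
    with s show "f n x = (Some \<circ> s) x" by simp
  qed
  show thesis
  proof (rule that)
    show "s (s x) = x" for x
    proof -
      have "f (N x) (s x) = Some x" using admissible_sym[OF f(1) s] .
      then show ?thesis using le[of "N x"] unfolding map_le_def by (metis comp_apply domI option.inject)
    qed
    show "requirement r (Some \<circ> s)" for r
      using req[of r] requirement_mono[OF le] by blast
  qed
qed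

section \<open>Highly transitive actions\<close>

lemma highly_transitive_actionI:
  assumes "countable X" "infinite X" "group_action G X \<phi>"
    and "\<And>xs ys. \<lbrakk>set xs \<subseteq> X; set ys \<subseteq> X; distinct xs; distinct ys; length xs = length ys\<rbrakk>
      \<Longrightarrow> \<exists>g\<in>carrier G. map (\<phi> g) xs = ys"
  shows "highly_transitive_action G X \<phi>"
  unfolding highly_transitive_action_def
proof (intro conjI allI impI assms(1-3))
  fix k :: nat
  show "transitive_action G (injective_tuples X k) (diagonal_action X \<phi> k)"
  proof (intro transitive_action.intro transitive_action_axioms.intro
      group_action_diagonal_action[OF assms(3)])
    fix xs ys assume "xs \<in> injective_tuples X k" "ys \<in> injective_tuples X k"
    then show "\<exists>g\<in>carrier G. diagonal_action X \<phi> k g xs = ys"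
      using assms(4)[of xs ys] by (auto simp: injective_tuples_def diagonal_action_def)
  qed
qed

lemma highly_transitive_actionD:
  assumes "highly_transitive_action G X \<phi>" "set xs \<subseteq> X" "set ys \<subseteq> X" "distinct xs" "distinct ys"
    "length xs = length ys" "xs \<noteq> []"
  shows "\<exists>g\<in>carrier G. map (\<phi> g) xs = ys"
proof -
  have "length xs \<ge> 1" using assms(7) by (cases xs) simp_all
  then have "transitive_action G (injective_tuples X (length xs)) (diagonal_action X \<phi> (length xs))"
    using assms(1) unfolding highly_transitive_action_def by blast
  moreover have "xs \<in> injective_tuples X (length xs)" "ys \<in> injective_tuples X (length xs)"
    using assms by (simp_all add: injective_tuples_def)
  ultimately have "\<exists>g\<in>carrier G. diagonal_action X \<phi> (length xs) g xs = ys"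
    by (rule transitive_action.unique_orbit)
  then obtain g where g: "g \<in> carrier G" "diagonal_action X \<phi> (length xs) g xs = ys" ..
  then have "map (\<phi> g) xs = ys"
    using \<open>xs \<in> injective_tuples X (length xs)\<close> by (simp add: diagonal_action_def)
  with g(1) show ?thesis by blast
qed

lemma highly_transitive_pullback:
  assumes "highly_transitive_action H X \<phi>" "group G" "f \<in> hom G H" "f ` carrier G = carrier H"
  shows "highly_transitive_action G X (\<phi> \<circ> f)"
proof -
  have X: "countable X" "infinite X" "group_action H X \<phi>"
    using assms(1) by (simp_all add: highly_transitive_action_def)
  have \<phi>: "group_hom H (BijGroup X) \<phi>" using X(3) by (rule group_action.group_hom)
  have "\<phi> \<circ> f \<in> hom G (BijGroup X)"
    using assms(3) group_hom.homh[OF \<phi>] by (rule hom_compose)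
  then have act: "group_action G X (\<phi> \<circ> f)"
    using assms(2) by (simp add: group_action_def group_hom_def group_hom_axioms_def group_BijGroup)
  show ?thesis
  proof (rule highly_transitive_actionI[OF X(1,2) act])
    fix xs ys :: "'c list"
    assume xy: "set xs \<subseteq> X" "set ys \<subseteq> X" "distinct xs" "distinct ys" "length xs = length ys"
    show "\<exists>g\<in>carrier G. map ((\<phi> \<circ> f) g) xs = ys"
    proof (cases "xs = []")
      case True
      then show ?thesis using xy(5) group.is_monoid[OF assms(2)] monoid.one_closed by fastforce
    next
      case False
      then obtain h where h: "h \<in> carrier H" "map (\<phi> h) xs = ys"
        using highly_transitive_actionD[OF assms(1) xy] by blast
      then obtain g where "g \<in> carrier G" "h = f g" using assms(4) by blast
      with h(2) show ?thesis by auto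
    qed
  qed
qed

lemma faithful_pullback:
  assumes "faithful_action H X \<phi>" "group G" "f \<in> hom G H" "inj_on f (carrier G)"
  shows "faithful_action G X (\<phi> \<circ> f)"
proof -
  interpret faithful_action H X \<phi> by fact
  have "\<phi> \<circ> f \<in> hom G (BijGroup X)"
    using assms(3) group_hom.homh[OF group_hom] by (rule hom_compose)
  then have "group_action G X (\<phi> \<circ> f)"
    using assms(2) by (simp add: group_action_def group_hom_def group_hom_axioms_def group_BijGroup)
  moreover have "f ` carrier G \<subseteq> carrier H" using assms(3) by (auto simp: hom_def)
  then have "inj_on (\<phi> \<circ> f) (carrier G)"
    using assms(4) faithful by (intro comp_inj_on) (auto intro: inj_on_subset)
  ultimately show ?thesis by (simp add: faithful_action_def faithful_action_axioms_def)
qed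

text \<open>If \<open>z\<close> moved \<open>x\<close>, some \<open>g\<close> would fix \<open>x\<close> and move \<open>\<phi> z x\<close>. But \<open>g\<close> commutes with \<open>z\<close>, so it must fix
  \<open>\<phi> z x\<close> along with \<open>x\<close>.\<close>

lemma central_acts_trivially:
  assumes "highly_transitive_action G X \<phi>" "z \<in> carrier G"
    and central: "\<And>g. g \<in> carrier G \<Longrightarrow> z \<otimes>\<^bsub>G\<^esub> g = g \<otimes>\<^bsub>G\<^esub> z"
    and "x \<in> X"
  shows "\<phi> z x = x"
proof (rule ccontr)
  assume neq: "\<phi> z x \<noteq> x"
  have X: "infinite X" "group_action G X \<phi>"
    using assms(1) by (simp_all add: highly_transitive_action_def)
  interpret group_action G X \<phi> by fact
  have zx: "\<phi> z x \<in> X" using element_image[OF assms(2,4)] by simp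
  obtain y where y: "y \<in> X" "y \<noteq> x" "y \<noteq> \<phi> z x"
    using X(1) infinite_arbitrarily_large[of X 3] by (metis (no_types, lifting) finite.emptyI finite.insertI finite_subset insertCI subsetI)
  obtain g where g: "g \<in> carrier G" "map (\<phi> g) [x, \<phi> z x] = [x, y]"
    using highly_transitive_actionD[OF assms(1), of "[x, \<phi> z x]" "[x, y]"] y neq zx assms(4) by auto
  have "\<phi> z x = \<phi> z (\<phi> g x)" using g(2) by simp
  also have "\<dots> = \<phi> g (\<phi> z x)"
    using composition_rule[OF assms(4,2) g(1)] composition_rule[OF assms(4) g(1) assms(2)] central[OF g(1)] by simp
  also have "\<dots> = y" using g(2) by simp
  finally show False using y(3) by simp
qed

lemma run_total:
  assumes "s \<in> Bij UNIV" "rot \<in> Bij UNIV"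
  shows "run (Some \<circ> s) w x = Some (eval_word (BijGroup UNIV) s rot w x)"
proof -
  interpret group "BijGroup (UNIV :: nat set)" by (rule group_BijGroup)
  have car: "s \<in> carrier (BijGroup UNIV)" "rot \<in> carrier (BijGroup UNIV)"
    using assms by (simp_all add: BijGroup_def)
  have one: "\<one>\<^bsub>BijGroup UNIV\<^esub> = (\<lambda>x::nat. x)" by (simp add: BijGroup_def restrict_UNIV)
  have mult: "(f \<otimes>\<^bsub>BijGroup UNIV\<^esub> g) x = f (g x)"
    if "f \<in> carrier (BijGroup UNIV)" "g \<in> carrier (BijGroup UNIV)" for f g :: "nat \<Rightarrow> nat" and x
    using that by (simp add: BijGroup_def compose_def)
  show ?thesis
  proof (induction w)
    case (Cons c w)
    then show ?case using mult[OF _ eval_word_closed[OF car]] car by (cases c) simp_all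
  qed (simp add: one)
qed

lemma Z2_Z3_action:
  obtains \<phi> :: "(int + int) list set \<Rightarrow> nat \<Rightarrow> nat"
  where "highly_transitive_action Z2_Z3 UNIV \<phi>" "faithful_action Z2_Z3 UNIV \<phi>"
proof -
  obtain s :: "nat \<Rightarrow> nat" where s: "\<And>x. s (s x) = x" "\<And>r. requirement r (Some \<circ> s)"
    by (rule generic_involution) blast
  let ?K = "BijGroup (UNIV :: nat set)"
  have K: "group ?K" by (rule group_BijGroup)
  have "bij s" using s(1) by (intro o_bij[of s s]) auto
  then have s_Bij: "s \<in> Bij UNIV" by (simp add: Bij_def)
  have "bij rot" by (rule o_bij[of "rot \<circ> rot"]) auto
  then have rot_Bij: "rot \<in> Bij UNIV" by (simp add: Bij_def)
  have car: "s \<in> carrier ?K" "rot \<in> carrier ?K" using s_Bij rot_Bij by (simp_all add: BijGroup_def)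
  have rel: "s \<otimes>\<^bsub>?K\<^esub> s = \<one>\<^bsub>?K\<^esub>" "rot \<otimes>\<^bsub>?K\<^esub> (rot \<otimes>\<^bsub>?K\<^esub> rot) = \<one>\<^bsub>?K\<^esub>"
    using s_Bij rot_Bij compose_Bij[OF rot_Bij rot_Bij]
    by (auto simp: BijGroup_def compose_def s(1) restrict_UNIV)
  obtain \<phi> where \<phi>: "\<phi> \<in> hom Z2_Z3 ?K" "\<phi> gen2 = s" "\<phi> gen3 = rot"
    using Z2_Z3_lift[OF K car rel] .
  have act: "group_action Z2_Z3 UNIV \<phi>"
    using \<phi>(1) K group_Z2_Z3 by (simp add: group_action_def group_hom_def group_hom_axioms_def)
  have ev: "\<phi> (eval_word Z2_Z3 gen2 gen3 w) x = y" if "run (Some \<circ> s) w x = Some y" for w x y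
    using hom_eval_word[OF group_Z2_Z3 K \<phi>(1) gens_in_Z2_Z3, of w] run_total[OF s_Bij rot_Bij, of w x] that
    by (simp add: \<phi>(2,3))
  have "highly_transitive_action Z2_Z3 UNIV \<phi>"
  proof (rule highly_transitive_actionI[OF _ _ act])
    fix xs ys :: "nat list" assume xy: "distinct xs" "distinct ys" "length xs = length ys"
    then obtain w where w: "\<And>i. i < length xs \<Longrightarrow> run (Some \<circ> s) w (xs ! i) = Some (ys ! i)"
      using s(2)[of "Inr (Inl (xs, ys))"] by auto
    have "map (\<phi> (eval_word Z2_Z3 gen2 gen3 w)) xs = ys"
      using ev[OF w] xy(3) by (intro nth_equalityI) simp_all
    moreover have "eval_word Z2_Z3 gen2 gen3 w \<in> carrier Z2_Z3"
      by (rule group.eval_word_closed[OF group_Z2_Z3 gens_in_Z2_Z3])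
    ultimately show "\<exists>g\<in>carrier Z2_Z3. map (\<phi> g) xs = ys" by blast
  qed simp_all
  moreover have "inj_on \<phi> (carrier Z2_Z3)"
  proof (rule Z2_Z3_inj[OF K \<phi>(1)])
    fix w assume "w \<in> normal_words" "w \<noteq> []"
    then obtain x y where "run (Some \<circ> s) w x = Some y" "y \<noteq> x"
      using s(2)[of "Inr (Inr w)"] by auto
    then have "eval_word ?K s rot w x \<noteq> x" using run_total[OF s_Bij rot_Bij, of w x] by simp
    moreover have "\<one>\<^bsub>?K\<^esub> x = x" by (simp add: BijGroup_def)
    ultimately show "eval_word ?K (\<phi> gen2) (\<phi> gen3) w \<noteq> \<one>\<^bsub>?K\<^esub>" unfolding \<phi>(2,3) by metis
  qed
  then have "faithful_action Z2_Z3 UNIV \<phi>"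
    using act by (simp add: faithful_action_def faithful_action_axioms_def)
  ultimately show thesis by (rule that)
qed

lemma SL2Z_not_faithful:
  assumes "highly_transitive_action SL2Z X \<phi>"
  shows "\<not> faithful_action SL2Z X \<phi>"
proof
  assume "faithful_action SL2Z X \<phi>"
  then interpret faithful_action SL2Z X \<phi> .
  let ?z = "mat22 (-1) 0 0 (-1)"
  have z: "?z \<in> carrier SL2Z" by simp
  have "?z \<otimes>\<^bsub>SL2Z\<^esub> g = g \<otimes>\<^bsub>SL2Z\<^esub> ?z" for g
    by (cases g rule: mat22_exhaust) simp
  then have "\<phi> ?z x = x" if "x \<in> X" for x
    using central_acts_trivially[OF assms z _ that] by blast
  then have "\<phi> ?z x = \<phi> \<one>\<^bsub>SL2Z\<^esub> x" if "x \<in> X" for x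
    using that unfolding id_eq_one[symmetric] by simp
  moreover have "\<phi> ?z \<in> extensional X" "\<phi> \<one>\<^bsub>SL2Z\<^esub> \<in> extensional X"
    using bij_prop0[OF z] bij_prop0[of "\<one>\<^bsub>SL2Z\<^esub>"] by (simp_all add: Bij_def one_SL2Z)
  ultimately have "\<phi> ?z = \<phi> \<one>\<^bsub>SL2Z\<^esub>"
    by (intro extensionalityI)
  then have "?z = \<one>\<^bsub>SL2Z\<^esub>"
    using inj_onD[OF faithful, of ?z "\<one>\<^bsub>SL2Z\<^esub>"] z by (simp add: one_SL2Z)
  then show False by (simp add: one_SL2Z)
qed

theorem mainTheorem2:
  shows "PSL2Z \<cong> free_product (integer_mod_group 2) (integer_mod_group 3)
    \<and> (\<exists>(X :: nat set) \<phi>. highly_transitive_action PSL2Z X \<phi> \<and> faithful_action PSL2Z X \<phi>)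
    \<and> (\<exists>(X :: nat set) \<phi>. highly_transitive_action SL2Z X \<phi>)
    \<and> \<not> (\<exists>(X :: 'a set) \<phi>. highly_transitive_action SL2Z X \<phi> \<and> faithful_action SL2Z X \<phi>)"
proof -
  obtain h where "h \<in> iso Z2_Z3 PSL2Z" by (rule PSL2Z_iso)
  then have iso: "PSL2Z \<cong> Z2_Z3"
    using group.iso_sym[OF group_Z2_Z3] by (auto simp: is_iso_def)
  then obtain k where k: "k \<in> iso PSL2Z Z2_Z3" by (auto simp: is_iso_def)
  then have k_hom: "k \<in> hom PSL2Z Z2_Z3" and k_inj: "inj_on k (carrier PSL2Z)"
    and k_surj: "k ` carrier PSL2Z = carrier Z2_Z3"
    by (simp_all add: iso_def bij_betw_def)
  obtain \<phi> :: "(int + int) list set \<Rightarrow> nat \<Rightarrow> nat"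
    where \<phi>: "highly_transitive_action Z2_Z3 UNIV \<phi>" "faithful_action Z2_Z3 UNIV \<phi>"
    by (rule Z2_Z3_action)
  have PSL: "highly_transitive_action PSL2Z UNIV (\<phi> \<circ> k)" "faithful_action PSL2Z UNIV (\<phi> \<circ> k)"
    using highly_transitive_pullback[OF \<phi>(1) group_PSL2Z k_hom k_surj]
      faithful_pullback[OF \<phi>(2) group_PSL2Z k_hom k_inj] .
  have SL: "highly_transitive_action SL2Z UNIV (\<phi> \<circ> k \<circ> proj)"
    using highly_transitive_pullback[OF PSL(1) group_SL2Z proj_hom proj_surj] .
  show ?thesis using iso PSL SL SL2Z_not_faithful by blast
qed

end
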